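(* Let $P_{Y_1\cdots Y_K|X}$ be a discrete memoryless degraded broadcast channel with receiver caches of sizes $M_1,\dots,M_K\ge0$, as described in the context. Then \[ C(M_1,\dots,M_K)\le\min_{\emptyset\ne\mathcal S\subseteq\{1,\dots,K\}}\left(R_{\mathrm{sym},\mathcal S}+\frac{M_{\mathcal S}}{D}\right), \] where $M_{\mathcal S}=\sum_{k\in\mathcal S}M_k$.
   Context: A discrete memoryless broadcast channel with input alphabet $\mathcal X$, $K$ receivers with output alphabets $\mathcal Y_1,\dots,\mathcal Y_K$, and transition law $P_{Y_1\cdots Y_K|X}$, is degraded if $X - Y_K - Y_{K-1} - \cdots - Y_1$ forms a Markov chain. Library: $D\ge K$ independent messages $W_1,\dots,W_D$, each uniform on $\{1,\dots,\lfloor2^{nR}\rfloor\}$. Caching phase (demands unknown): receiver $k$ stores $V_k=g_k(W_1,\dots,W_D)\in\{1,\dots,\lfloor2^{nM_k}\rfloor\}$. Delivery: an arbitrary demand vector $\mathbf d=(d_1,\dots,d_K)\in\{1,\dots,D\}^K$ is known to all; the transmitter sends $X^n=f_{\mathbf d}(W_1,\dots,W_D)\in\mathcal X^n$ over the memoryless channel; receiver $k$ outputs $\hat W_k=\varphi_{k,\mathbf d}(Y_k^n,V_k)$. The rate-memory tuple $(R,M_1,\dots,M_K)$ is achievable if for every $\epsilon>0$ there exist $n$ and such functions with $\max_{\mathbf d}\Pr[\bigcup_k\{\hat W_k\ne W_{d_k}\}]<\epsilon$; $C(M_1,\dots,M_K)$ is the supremum of such $R$. For nonempty $\mathcal S\subseteq\{1,\dots,K\}$,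 $R_{\mathrm{sym},\mathcal S}$ denotes the largest rate $R$ such that, over the same broadcast channel restricted to the receivers in $\mathcal S$ and with no caches, independent messages of common rate $R$, one for each receiver in $\mathcal S$, can be reliably communicated (the symmetric capacity of that sub-broadcast channel).
   Formalization: Achievability (for the cache capacity and for the symmetric capacity) is taken as "for every ε>0, for all sufficiently large n there are such functions"; with just "there exist n", n=1 makes every R<1 achievable on any channel and the bound fails. *)

theory Defs
  imports "HOL-Probability.Probability" "HOL-Library.FuncSet"
begin

text \<open>A discrete memoryless broadcast channel: input alphabet 'x (finite), one common
finite output alphabet 'y for all receivers; W x is the joint law of the outputs,
receiver k (1 \<le> k \<le> K) observing coordinate k.\<close>

definition num_msgs :: "nat \<Rightarrow> real \<Rightarrow> nat" where
  "num_msgs n R = nat \<lfloor>2 powr (real n * R)\<rfloor>"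

definition msg_pmf :: "nat set \<Rightarrow> nat \<Rightarrow> (nat \<Rightarrow> nat) pmf" where
  "msg_pmf I L = Pi_pmf I undefined (\<lambda>_. pmf_of_set {1..L})"

text \<open>n uses of the memoryless channel; Y i k is the output of receiver k at time i.\<close>
definition chan_n :: "('x \<Rightarrow> (nat \<Rightarrow> 'y) pmf) \<Rightarrow> nat \<Rightarrow> (nat \<Rightarrow> 'x) \<Rightarrow> (nat \<Rightarrow> nat \<Rightarrow> 'y) pmf" where
  "chan_n W n xs = Pi_pmf {..<n} undefined (\<lambda>i. W (xs i))"

text \<open>Degradedness X - Y_K - ... - Y_1 (Markov chain), as factorisation of the joint law.\<close>
definition degraded :: "('x \<Rightarrow> (nat \<Rightarrow> 'y) pmf) \<Rightarrow> nat \<Rightarrow> bool" where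
  "degraded W K \<longleftrightarrow> (\<exists>Q :: nat \<Rightarrow> 'y \<Rightarrow> 'y pmf. \<forall>x. \<forall>y \<in> extensional {1..K}.
     pmf (map_pmf (\<lambda>z. restrict z {1..K}) (W x)) y =
     pmf (map_pmf (\<lambda>z. z K) (W x)) (y K) * (\<Prod>k\<in>{1..<K}. pmf (Q k (y (Suc k))) (y k)))"

definition cache_err ::
  "('x \<Rightarrow> (nat \<Rightarrow> 'y) pmf) \<Rightarrow> nat \<Rightarrow> nat \<Rightarrow> nat \<Rightarrow> nat \<Rightarrow>
   ((nat \<Rightarrow> nat) \<Rightarrow> (nat \<Rightarrow> nat) \<Rightarrow> nat \<Rightarrow> 'x) \<Rightarrow> (nat \<Rightarrow> (nat \<Rightarrow> nat) \<Rightarrow> nat) \<Rightarrow>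
   (nat \<Rightarrow> (nat \<Rightarrow> nat) \<Rightarrow> (nat \<Rightarrow> 'y) \<Rightarrow> nat \<Rightarrow> nat) \<Rightarrow> (nat \<Rightarrow> nat) \<Rightarrow> real" where
  "cache_err W K D n L f g \<phi> d =
     measure_pmf.prob
       (bind_pmf (msg_pmf {1..D} L) (\<lambda>w. map_pmf (\<lambda>Y. (w, Y)) (chan_n W n (f d w))))
       {(w, Y). \<exists>k\<in>{1..K}. \<phi> k d (\<lambda>i. Y i k) (g k w) \<noteq> w (d k)}"

definition cache_achievable ::
  "('x \<Rightarrow> (nat \<Rightarrow> 'y) pmf) \<Rightarrow> nat \<Rightarrow> nat \<Rightarrow> (nat \<Rightarrow> real) \<Rightarrow> real \<Rightarrow> bool" where
  "cache_achievable W K D M R \<longleftrightarrow> R \<ge> 0 \<and>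
     (\<forall>\<epsilon>>0. \<exists>N. \<forall>n\<ge>N. \<exists>(f :: (nat \<Rightarrow> nat) \<Rightarrow> (nat \<Rightarrow> nat) \<Rightarrow> nat \<Rightarrow> 'x) g \<phi>.
        (\<forall>k\<in>{1..K}. \<forall>w\<in>set_pmf (msg_pmf {1..D} (num_msgs n R)). g k w \<in> {1..num_msgs n (M k)}) \<and>
        (\<forall>d \<in> {1..K} \<rightarrow>\<^sub>E {1..D}. cache_err W K D n (num_msgs n R) f g \<phi> d < \<epsilon>))"

definition cache_capacity ::
  "('x \<Rightarrow> (nat \<Rightarrow> 'y) pmf) \<Rightarrow> nat \<Rightarrow> nat \<Rightarrow> (nat \<Rightarrow> real) \<Rightarrow> real" where
  "cache_capacity W K D M = Sup {R. cache_achievable W K D M R}"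

definition sym_err ::
  "('x \<Rightarrow> (nat \<Rightarrow> 'y) pmf) \<Rightarrow> nat set \<Rightarrow> nat \<Rightarrow> nat \<Rightarrow>
   ((nat \<Rightarrow> nat) \<Rightarrow> nat \<Rightarrow> 'x) \<Rightarrow> (nat \<Rightarrow> (nat \<Rightarrow> 'y) \<Rightarrow> nat) \<Rightarrow> real" where
  "sym_err W S n L f \<phi> =
     measure_pmf.prob
       (bind_pmf (msg_pmf S L) (\<lambda>w. map_pmf (\<lambda>Y. (w, Y)) (chan_n W n (f w))))
       {(w, Y). \<exists>k\<in>S. \<phi> k (\<lambda>i. Y i k) \<noteq> w k}"

definition sym_achievable :: "('x \<Rightarrow> (nat \<Rightarrow> 'y) pmf) \<Rightarrow> nat set \<Rightarrow> real \<Rightarrow> bool" where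
  "sym_achievable W S R \<longleftrightarrow> R \<ge> 0 \<and>
     (\<forall>\<epsilon>>0. \<exists>N. \<forall>n\<ge>N. \<exists>(f :: (nat \<Rightarrow> nat) \<Rightarrow> nat \<Rightarrow> 'x) \<phi>.
        sym_err W S n (num_msgs n R) f \<phi> < \<epsilon>)"

definition sym_capacity :: "('x \<Rightarrow> (nat \<Rightarrow> 'y) pmf) \<Rightarrow> nat set \<Rightarrow> real" where
  "sym_capacity W S = Sup {R. sym_achievable W S R}"

end

theory Submission
  imports Defs
begin

text \<open>
  A cache code for the full library is turned, at the same blocklength, into a cacheless code for
  the receivers in \<open>S\<close>; neither random coding nor a single-letter formula is needed. Discard the
  message tuples with large error probability and fix the most frequent cache content of the
  receivers in \<open>S\<close>: at least \<open>L\<^sup>D / (2 \<cdot> 2 powr (n M\<^sub>S))\<close> tuples of the library remain, and on them the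
  caches carry no information. With \<open>c\<^sup>D\<close> the number of remaining tuples, a peeling argument in the
  spirit of Loomis and Whitney orders the coordinates so that, up to a constant factor in size, each
  prefix of length \<open>j\<close> has at most \<open>c\<close> to the power \<open>D - j\<close> extensions. Let the receivers in \<open>S\<close>, from weakest to
  strongest, demand the files in this order. Greedy bin packing then labels the tuples by
  independent messages from an alphabet of size proportional to \<open>c\<close>, the \<open>j\<close>-th label depending only on the
  first \<open>j\<close> files. By degradedness the \<open>j\<close>-th receiver can simulate all weaker ones, hence recover
  these \<open>j\<close> files and its own label.
\<close>

subsection \<open>Peeling\<close>

text \<open>The words of \<open>A\<close> that look like \<open>w\<close> to an observer of the
  coordinates in \<open>T\<close>. The reference word \<open>w\<close> may lie outside
  \<open>A\<close>, so bounds can be stated for all \<open>w\<close> while \<open>A\<close>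
  shrinks.\<close>

definition fiber :: "('i \<Rightarrow> 'a) set \<Rightarrow> 'i set \<Rightarrow> ('i \<Rightarrow> 'a) \<Rightarrow> ('i \<Rightarrow> 'a) set" where
  "fiber A T w = {w' \<in> A. \<forall>i\<in>T. w' i = w i}"

lemma finite_fiber: "finite A \<Longrightarrow> finite (fiber A T w)"
  by (simp add: fiber_def)

lemma card_fiber_mono:
  assumes "finite B" "A \<subseteq> B" shows "card (fiber A T w) \<le> card (fiber B T w)"
  using assms by (intro card_mono finite_fiber) (auto simp: fiber_def)

text \<open>Coordinates are released one by one. Releasing \<open>u\<close> alone gives more than
  \<open>p * c\<close> words, at most \<open>p\<close> for each value of \<open>u\<close>, so more
  than \<open>c\<close> values occur. Words representing these values have fibers over
  \<open>T - U\<close> that are disjoint, since they differ at \<open>u\<close>, and large by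
  induction.\<close>

lemma card_fiber_thick:
  fixes p c :: real
  assumes fin: "finite A" and p: "p \<ge> 0" and c: "c \<ge> 0"
    and thin: "\<And>w. w \<in> A \<Longrightarrow> card (fiber A T w) \<le> p"
    and thick: "\<And>w i. w \<in> A \<Longrightarrow> i \<in> T \<Longrightarrow> p * c < card (fiber A (T - {i}) w)"
    and U: "finite U" "U \<noteq> {}" "U \<subseteq> T"
    and w: "w \<in> A"
  shows "p * c ^ card U < card (fiber A (T - U) w)"
  using U w
proof (induction U arbitrary: w rule: finite_ne_induct)
  case (singleton x)
  then show ?case using thick by simp
next
  case (insert u U)
  define G where "G = fiber A (T - {u}) w"
  define V where "V = (\<lambda>w'. w' u) ` G"
  have finG: "finite G" and GA: "G \<subseteq> A" using fin by (auto simp: G_def fiber_def)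
  have finV: "finite V" using finG by (simp add: V_def)
  have "G = (\<Union>a\<in>V. {w'\<in>G. w' u = a})" by (auto simp: V_def)
  then have "card G \<le> (\<Sum>a\<in>V. card {w'\<in>G. w' u = a})"
    using card_UN_le[OF finV, of "\<lambda>a. {w'\<in>G. w' u = a}"] by simp
  then have "real (card G) \<le> (\<Sum>a\<in>V. real (card {w'\<in>G. w' u = a}))"
    by (simp flip: of_nat_sum)
  also have "\<dots> \<le> (\<Sum>a\<in>V. p)"
  proof (rule sum_mono)
    fix a assume "a \<in> V"
    then obtain w1 where w1: "w1 \<in> G" "w1 u = a" by (auto simp: V_def)
    have "w' i = w1 i" if "w' \<in> G" "w' u = a" "i \<in> T" for w' i
      using w1 that by (cases "i = u") (auto simp: G_def fiber_def)
    then have "{w'\<in>G. w' u = a} \<subseteq> fiber A T w1" using GA by (auto simp: fiber_def)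
    then have "card {w'\<in>G. w' u = a} \<le> card (fiber A T w1)"
      by (intro card_mono finite_fiber fin)
    moreover have "w1 \<in> A" using w1 GA by blast
    ultimately show "real (card {w'\<in>G. w' u = a}) \<le> p" using thin[of w1] by linarith
  qed
  finally have "real (card G) \<le> real (card V) * p" by simp
  moreover have "p * c < card G" using thick insert.prems by (simp add: G_def)
  ultimately have "p * c < p * card V" by (simp add: mult.commute)
  then have cV: "c < card V" using p by (simp add: mult_less_cancel_left)
  then have V0: "V \<noteq> {}" using c by auto
  have "\<forall>a\<in>V. \<exists>w'\<in>G. w' u = a" by (auto simp: V_def)
  then obtain r where r: "\<And>a. a \<in> V \<Longrightarrow> r a \<in> G \<and> r a u = a" by metis
  have disj: "fiber A (T - U) (r a) \<inter> fiber A (T - U) (r b) = {}"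
    if "a \<in> V" "b \<in> V" "a \<noteq> b" for a b
    using that r[of a] r[of b] insert.hyps insert.prems by (auto simp: fiber_def)
  have sub: "(\<Union>a\<in>V. fiber A (T - U) (r a)) \<subseteq> fiber A (T - insert u U) w"
    using r by (fastforce simp: fiber_def G_def)
  have "p * c ^ card (insert u U) = c * (p * c ^ card U)" using insert.hyps by simp
  also have "\<dots> \<le> card V * (p * c ^ card U)"
    using cV p c by (intro mult_right_mono) auto
  also have "\<dots> = (\<Sum>a\<in>V. p * c ^ card U)" by simp
  also have "\<dots> < (\<Sum>a\<in>V. real (card (fiber A (T - U) (r a))))"
    using insert.IH r GA insert.prems finV V0 by (intro sum_strict_mono) auto
  also have "\<dots> = card (\<Union>a\<in>V. fiber A (T - U) (r a))"
    using disj finV fin by (subst card_UN_disjoint) (auto simp: finite_fiber)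
  also have "\<dots> \<le> card (fiber A (T - insert u U) w)"
    using sub by (simp add: card_mono finite_fiber fin)
  finally show ?case .
qed

text \<open>
  Lines with at most \<open>p * c\<close> points are removed one after another and assigned to their direction.
  Nothing can be left over, since a set in which all lines are thicker is too large by the preceding
  lemma.
\<close>

lemma peel_partition:
  fixes p c :: real
  assumes "finite A" and p: "p \<ge> 0" and c: "c \<ge> 0" and T: "finite T" "T \<noteq> {}"
    and "\<And>w. w \<in> A \<Longrightarrow> card (fiber A T w) \<le> p"
    and "card A \<le> p * c ^ card T"
  shows "\<exists>h. h ` A \<subseteq> T \<and> (\<forall>i\<in>T. \<forall>w. card (fiber {w'\<in>A. h w' = i} (T - {i}) w) \<le> p * c)"
  using assms(1,6,7)
proof (induction A rule: finite_psubset_induct)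
  case (psubset A)
  show ?case
  proof (cases "A = {}")
    case True
    then show ?thesis using p c by (auto simp: fiber_def)
  next
    case False
    then obtain w0 where w0: "w0 \<in> A" by blast
    \<comment> \<open>For \<open>U = T\<close> the released fiber is all of \<open>A\<close>, so
      thick lines everywhere would contradict the bound on \<open>card A\<close>.\<close>
    have "\<not> (\<forall>w\<in>A. \<forall>i\<in>T. p * c < card (fiber A (T - {i}) w))"
    proof
      assume *: "\<forall>w\<in>A. \<forall>i\<in>T. p * c < card (fiber A (T - {i}) w)"
      have "p * c ^ card T < card (fiber A (T - T) w0)"
        by (rule card_fiber_thick) (use psubset * p c T w0 in auto)
      then show False using psubset.prems(2) by (simp add: fiber_def)
    qed
    then obtain v i where v: "v \<in> A" "i \<in> T" "card (fiber A (T - {i}) v) \<le> p * c"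
      by force
    define F where "F = fiber A (T - {i}) v"
    have FA: "F \<subseteq> A" "v \<in> F" using v by (auto simp: F_def fiber_def)
    have "A - F \<subset> A" using FA v by auto
    moreover have "card (fiber (A - F) T w) \<le> p" if "w \<in> A - F" for w
    proof -
      have "card (fiber (A - F) T w) \<le> card (fiber A T w)"
        using psubset.hyps by (intro card_fiber_mono) auto
      then show ?thesis using psubset.prems(1)[of w] that by simp
    qed
    moreover have "card (A - F) \<le> p * c ^ card T"
    proof -
      have "card (A - F) \<le> card A" using psubset.hyps by (intro card_mono) auto
      then show ?thesis using psubset.prems(2) by linarith
    qed
    ultimately have "\<exists>h. h ` (A - F) \<subseteq> T \<and>
        (\<forall>i\<in>T. \<forall>w. card (fiber {w'\<in>A - F. h w' = i} (T - {i}) w) \<le> p * c)"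
      by (rule psubset.IH)
    then obtain h where h: "h ` (A - F) \<subseteq> T"
      "\<And>j w. j\<in>T \<Longrightarrow> card (fiber {w'\<in>A - F. h w' = j} (T - {j}) w) \<le> p * c"
      by blast
    define h' where "h' w = (if w \<in> F then i else h w)" for w
    have "card (fiber {w'\<in>A. h' w' = j} (T - {j}) w) \<le> p * c" if j: "j \<in> T" for j w
    \<comment> \<open>In the class of direction \<open>i\<close>, only the line through
      \<open>v\<close> meets \<open>F\<close>, and it lies inside \<open>F\<close>. All other fibers
      of the new classes avoid \<open>F\<close> and are bounded by induction.\<close>
    proof (cases "j = i \<and> (\<forall>l\<in>T - {i}. w l = v l)")
      case True
      then have "fiber {w'\<in>A. h' w' = j} (T - {j}) w \<subseteq> F"
        by (auto simp: F_def fiber_def)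
      then have "card (fiber {w'\<in>A. h' w' = j} (T - {j}) w) \<le> card F"
        using FA psubset.hyps by (meson card_mono finite_subset)
      then show ?thesis using v(3) by (simp add: F_def)
    next
      case False
      then have "fiber {w'\<in>A. h' w' = j} (T - {j}) w \<subseteq> fiber {w'\<in>A - F. h w' = j} (T - {j}) w"
        by (auto simp: F_def fiber_def h'_def)
      then have "card (fiber {w'\<in>A. h' w' = j} (T - {j}) w) \<le> card (fiber {w'\<in>A - F. h w' = j} (T - {j}) w)"
        using psubset.hyps by (intro card_mono finite_fiber) auto
      then show ?thesis using h(2)[OF j, of w] by linarith
    qed
    moreover have "h' ` A \<subseteq> T" using h(1) v(2) by (auto simp: h'_def)
    ultimately show ?thesis by blast
  qed
qed

lemma pigeonhole_card_class:
  assumes T: "finite T" "T \<noteq> {}" and h: "h ` A \<subseteq> T"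
  shows "\<exists>i\<in>T. card A \<le> card T * card {w\<in>A. h w = i}"
proof (rule ccontr)
  assume "\<not> ?thesis"
  then have *: "\<And>i. i\<in>T \<Longrightarrow> card T * card {w\<in>A. h w = i} < card A" by force
  have "card T * card A = card T * card (\<Union>i\<in>T. {w\<in>A. h w = i})"
    using h by (intro arg_cong2[where f="(*)"] arg_cong[where f=card]) auto
  also have "\<dots> \<le> card T * (\<Sum>i\<in>T. card {w\<in>A. h w = i})"
    using card_UN_le[OF T(1)] by (intro mult_le_mono) auto
  also have "\<dots> = (\<Sum>i\<in>T. card T * card {w\<in>A. h w = i})" by (simp add: sum_distrib_left)
  also have "\<dots> < (\<Sum>i\<in>T. card A)" using T * by (intro sum_strict_mono) auto
  finally show False by simp
qed

text \<open>Keeping a class of \<open>peel_partition\<close> of at least average size costs a factor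
  \<open>card T\<close>. Forgetting the coordinate \<open>i\<close> of that class then raises the
  fiber bound only by the factor \<open>c\<close>.\<close>

lemma peel_step:
  fixes p c :: real
  assumes "finite A" "p \<ge> 0" "c \<ge> 0" "finite T" "T \<noteq> {}"
    and "\<And>w. w \<in> A \<Longrightarrow> card (fiber A T w) \<le> p"
    and "card A \<le> p * c ^ card T"
  obtains i B where "i \<in> T" "B \<subseteq> A" "card A \<le> card T * card B"
    "\<And>w. card (fiber B (T - {i}) w) \<le> p * c"
proof -
  obtain h where h: "h ` A \<subseteq> T"
      "\<And>i w. i\<in>T \<Longrightarrow> card (fiber {w'\<in>A. h w' = i} (T - {i}) w) \<le> p * c"
    using peel_partition[OF assms] by blast
  then obtain i where i: "i \<in> T" "card A \<le> card T * card {w\<in>A. h w = i}"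
    using pigeonhole_card_class[OF assms(4,5)] by blast
  show ?thesis by (rule that[OF i(1) _ i(2) h(2)[OF i(1)]]) auto
qed

text \<open>The list \<open>ds\<close> grows at the front, so the order is found from its end
  backwards. \<open>T\<close> holds the coordinates not yet listed, and \<open>peel_step\<close>
  with \<open>p = c ^ r\<close> picks the next one. Its size condition persists because
  \<open>r + card T = card I\<close> and the set only shrinks, which also preserves the earlier
  fiber bounds.\<close>

lemma peel_ordering_aux:
  fixes c :: real
  assumes fin: "finite A" and I: "finite I" and ext: "A \<subseteq> extensional I"
    and c: "c \<ge> 0" and A: "card A \<le> c ^ card I" and r: "r \<le> card I"
  shows "\<exists>ds B. distinct ds \<and> set ds \<subseteq> I \<and> length ds = r \<and> B \<subseteq> A \<and> card A \<le> card I ^ r * card B \<and>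
    (\<forall>j\<le>r. \<forall>w\<in>B. card (fiber B (I - set (drop j ds)) w) \<le> c ^ (r - j))"
  using r
proof (induction r)
  case 0
  \<comment> \<open>Words in \<open>extensional I\<close> are determined by their values on
    \<open>I\<close>.\<close>
  have "card (fiber A I w) \<le> 1" if "w \<in> A" for w
  proof -
    have "fiber A I w = {w}"
      using that ext by (auto simp: fiber_def extensional_def subset_iff fun_eq_iff) metis
    then show ?thesis by simp
  qed
  then show ?case by (intro exI[of _ "[]"] exI[of _ A]) simp
next
  case (Suc r)
  then obtain ds B where ds: "distinct ds" "set ds \<subseteq> I" "length ds = r" "B \<subseteq> A"
    "card A \<le> card I ^ r * card B"
    "\<And>j w. j\<le>r \<Longrightarrow> w\<in>B \<Longrightarrow> card (fiber B (I - set (drop j ds)) w) \<le> c ^ (r - j)"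
    by auto
  define T where "T = I - set ds"
  have cT: "card T = card I - r"
    using ds I by (simp add: T_def card_Diff_subset distinct_card)
  have finB: "finite B" using ds fin finite_subset by blast
  have pc: "c ^ r * c ^ card T = c ^ card I" using cT Suc.prems by (simp flip: power_add)
  have "card B \<le> card A" using ds fin card_mono by blast
  then have cB: "card B \<le> c ^ r * c ^ card T" using A pc by linarith
  obtain i B' where B': "i \<in> T" "B' \<subseteq> B" "card B \<le> card T * card B'"
    "\<And>w. card (fiber B' (T - {i}) w) \<le> c ^ r * c"
  proof (rule peel_step[of B "c ^ r" c T])
    show "T \<noteq> {}" using cT Suc.prems by force
    show "real (card (fiber B T w)) \<le> c ^ r" if "w \<in> B" for w
      using ds(6)[of 0 w] that by (simp add: T_def)
  qed (use finB c I cB in \<open>auto simp: T_def\<close>)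
  have "card A \<le> card I ^ r * (card I * card B')"
  proof -
    have "card B \<le> card I * card B'" using B'(3) cT by (metis diff_le_self le_trans mult_le_mono1)
    then show ?thesis using ds(5) by (meson le_trans mult_le_mono2)
  qed
  moreover have "card (fiber B' (I - set (drop j (i # ds))) w) \<le> c ^ (Suc r - j)"
    if "j \<le> Suc r" "w \<in> B'" for j w
  \<comment> \<open>Position 0 carries the bound just peeled; position \<open>Suc j'\<close> carries
    the old bound at \<open>j'\<close>.\<close>
  proof (cases j)
    case 0
    have "I - set (i # ds) = T - {i}" by (auto simp: T_def)
    then show ?thesis using B'(4)[of w] 0 by (simp add: mult.commute)
  next
    case (Suc j')
    then show ?thesis
      using card_fiber_mono[OF finB B'(2), of "I - set (drop j' ds)" w] ds(6)[of j' w] that B'(2)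
      by (auto simp: subset_iff)
  qed
  ultimately show ?case using ds B' 
    by (intro exI[of _ "i # ds"] exI[of _ B']) (auto simp: T_def mult_ac)
qed

text \<open>Once every coordinate is listed, forgetting the last ones means knowing a prefix of
  \<open>ds\<close>. This is the form in which the labelling uses the bounds.\<close>

lemma peel_ordering:
  fixes c :: real
  assumes "finite A" and I: "finite I" and "A \<subseteq> extensional I"
    and "c \<ge> 0" and "card A \<le> c ^ card I"
  obtains ds B where "distinct ds" "set ds = I" "B \<subseteq> A" "card A \<le> card I ^ card I * card B"
    "\<And>j w. j \<le> card I \<Longrightarrow> w \<in> B \<Longrightarrow> card (fiber B (set (take j ds)) w) \<le> c ^ (card I - j)"
proof -
  obtain ds B where ds: "distinct ds" "set ds \<subseteq> I" "length ds = card I" "B \<subseteq> A"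
    "card A \<le> card I ^ card I * card B"
    "\<And>j w. j\<le>card I \<Longrightarrow> w\<in>B \<Longrightarrow> card (fiber B (I - set (drop j ds)) w) \<le> c ^ (card I - j)"
    using peel_ordering_aux[OF assms order_refl] by blast
  have eq: "set ds = I" using ds I by (metis card_subset_eq distinct_card)
  have "I - set (drop j ds) = set (take j ds)" for j
    using ds(1) unfolding eq[symmetric]
    by (subst (1) append_take_drop_id[of j ds, symmetric], subst set_append)
      (use set_take_disj_set_drop_if_distinct[of ds j j] in auto)
  then show ?thesis using that ds eq by simp
qed

subsection \<open>Labelling by independent messages\<close>

text \<open>Whole classes of equal \<open>\<kappa>\<close> are added to a bin until it first holds
  \<open>X\<close> words. The last class adds at most \<open>X\<close>, so the bin takes at most
  \<open>2 * X\<close> words and enough remain for the other bins. No class is split, hence the bin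
  number is a function of \<open>\<kappa> w\<close>.\<close>

lemma bin_packing:
  fixes X :: real
  assumes "finite G" and X: "X > 0" and "\<And>a. card {w\<in>G. \<kappa> w = a} \<le> X"
    and "2 * real l * X \<le> card G"
  shows "\<exists>h. \<forall>m\<in>{1..l}. X \<le> card {w\<in>G. h (\<kappa> w) = m}"
  using assms(1,3,4)
proof (induction l arbitrary: G)
  case 0
  then show ?case by simp
next
  case (Suc l)
  have *: "\<exists>P\<subseteq>Q. X \<le> card {w\<in>G. \<kappa> w \<in> P} \<and> card {w\<in>G. \<kappa> w \<in> P} \<le> 2 * X"
    if "finite Q" "X \<le> card {w\<in>G. \<kappa> w \<in> Q}" for Q
    using that
  proof (induction Q)
    case empty
    then show ?case using X by simp
  next
    case (insert a Q)
    show ?case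
    proof (cases "X \<le> card {w\<in>G. \<kappa> w \<in> Q}")
      case True
      then show ?thesis using insert.IH by blast
    next
      case False
      have "{w\<in>G. \<kappa> w \<in> insert a Q} = {w\<in>G. \<kappa> w = a} \<union> {w\<in>G. \<kappa> w \<in> Q}" by auto
      then have "card {w\<in>G. \<kappa> w \<in> insert a Q} \<le> card {w\<in>G. \<kappa> w = a} + card {w\<in>G. \<kappa> w \<in> Q}"
        by (simp only: card_Un_le)
      then have "card {w\<in>G. \<kappa> w \<in> insert a Q} \<le> 2 * X"
        using False Suc.prems(2)[of a] by linarith
      then show ?thesis using insert.prems by blast
    qed
  qed
  have "{w\<in>G. \<kappa> w \<in> \<kappa> ` G} = G" by auto
  moreover have "X \<le> card G"
  proof -
    have "X * 1 \<le> X * (2 * real (Suc l))" using X by (intro mult_left_mono) auto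
    then show ?thesis using Suc.prems(3) by (simp add: mult_ac)
  qed
  ultimately obtain P where P: "X \<le> card {w\<in>G. \<kappa> w \<in> P}" "card {w\<in>G. \<kappa> w \<in> P} \<le> 2 * X"
    using *[of "\<kappa> ` G"] Suc.prems(1) by auto
  define G' where "G' = {w\<in>G. \<kappa> w \<notin> P}"
  have "G = {w\<in>G. \<kappa> w \<in> P} \<union> G'" by (auto simp: G'_def)
  then have "card G \<le> card {w\<in>G. \<kappa> w \<in> P} + card G'" using card_Un_le by metis
  then have "2 * real l * X \<le> card G'" using Suc.prems(3) P(2) by (simp add: algebra_simps)
  moreover have "card {w\<in>G'. \<kappa> w = a} \<le> X" for a
  proof -
    have "card {w\<in>G'. \<kappa> w = a} \<le> card {w\<in>G. \<kappa> w = a}"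
      using Suc.prems(1) by (intro card_mono) (auto simp: G'_def)
    then show ?thesis using Suc.prems(2)[of a] by linarith
  qed
  moreover have "finite G'" using Suc.prems(1) by (simp add: G'_def)
  ultimately obtain h where h: "\<And>m. m\<in>{1..l} \<Longrightarrow> X \<le> card {w\<in>G'. h (\<kappa> w) = m}"
    using Suc.IH[of G'] by metis
  have "X \<le> card {w\<in>G. (if \<kappa> w \<in> P then Suc l else h (\<kappa> w)) = m}" if m: "m \<in> {1..Suc l}" for m
  proof (cases "m = Suc l")
    case True
    have "card {w\<in>G. \<kappa> w \<in> P} \<le> card {w\<in>G. (if \<kappa> w \<in> P then Suc l else h (\<kappa> w)) = m}"
      using Suc.prems(1) True by (intro card_mono) auto
    then show ?thesis using P by linarith
  next
    case False
    have "card {w\<in>G'. h (\<kappa> w) = m} \<le> card {w\<in>G. (if \<kappa> w \<in> P then Suc l else h (\<kappa> w)) = m}"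
      using Suc.prems(1) by (intro card_mono) (auto simp: G'_def)
    then show ?thesis using h[of m] m False by force
  qed
  then show ?case by (intro exI[of _ "\<lambda>a. if a \<in> P then Suc l else h a"]) auto
qed

text \<open>Words sharing the first \<open>r\<close> labels form a class of at least
  \<open>X r\<close> words, while fibers over \<open>T (Suc r)\<close> have at most
  \<open>X (Suc r)\<close>. By \<open>step\<close>, such a class can be packed into \<open>l\<close>
  bins, whose numbers are the next label. The packing varies with the class, but the class is itself
  determined by the coordinates in \<open>T (Suc r)\<close>, because \<open>T\<close> is
  increasing.\<close>

lemma successive_labelling_aux:
  fixes X :: "nat \<Rightarrow> real"
  assumes fin: "finite A" and pos: "\<And>j. X j > 0"
    and thin: "\<And>j w. j \<in> {1..s} \<Longrightarrow> w \<in> A \<Longrightarrow> card (fiber A (T j) w) \<le> X j"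
    and step: "\<And>j. j < s \<Longrightarrow> 2 * real l * X (Suc j) \<le> X j"
    and A: "X 0 \<le> card A"
    and mono: "mono T" and r: "r \<le> s"
  shows "\<exists>H. (\<forall>j\<in>{1..r}. \<forall>w\<in>A. \<forall>w'\<in>A. (\<forall>i\<in>T j. w i = w' i) \<longrightarrow> H j w = (H j w' :: nat)) \<and>
     (\<forall>m. (\<forall>j\<in>{1..r}. m j \<in> {1..l}) \<longrightarrow> X r \<le> card {w\<in>A. \<forall>j\<in>{1..r}. H j w = m j})"
  using r
proof (induction r)
  case 0
  then show ?case using A by simp
next
  case (Suc r)
  have "\<exists>H. (\<forall>j\<in>{1..r}. \<forall>w\<in>A. \<forall>w'\<in>A. (\<forall>i\<in>T j. w i = w' i) \<longrightarrow> H j w = (H j w' :: nat)) \<and>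
     (\<forall>m. (\<forall>j\<in>{1..r}. m j \<in> {1..l}) \<longrightarrow> X r \<le> card {w\<in>A. \<forall>j\<in>{1..r}. H j w = m j})"
    by (rule Suc.IH) (use Suc.prems in simp)
  then obtain H where H0: "(\<forall>j\<in>{1..r}. \<forall>w\<in>A. \<forall>w'\<in>A. (\<forall>i\<in>T j. w i = w' i) \<longrightarrow> H j w = (H j w' :: nat)) \<and>
     (\<forall>m. (\<forall>j\<in>{1..r}. m j \<in> {1..l}) \<longrightarrow> X r \<le> card {w\<in>A. \<forall>j\<in>{1..r}. H j w = m j})" ..
  have H: "\<And>j w w'. j\<in>{1..r} \<Longrightarrow> w\<in>A \<Longrightarrow> w'\<in>A \<Longrightarrow> (\<forall>i\<in>T j. w i = w' i) \<Longrightarrow> H j w = H j w'"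
    "\<And>m. (\<forall>j\<in>{1..r}. m j \<in> {1..l}) \<Longrightarrow> X r \<le> card {w\<in>A. \<forall>j\<in>{1..r}. H j w = m j}"
    using H0 by blast+
  define \<kappa> where "\<kappa> w = restrict w (T (Suc r))" for w :: "'a \<Rightarrow> 'b"
  define Q where "Q G h \<longleftrightarrow> (\<forall>m\<in>{1..l}. X (Suc r) \<le> card {w\<in>G. h (\<kappa> w) = m})"
    for G and h :: "('a \<Rightarrow> 'b) \<Rightarrow> nat"
  define cls where "cls w = {w'\<in>A. \<forall>j\<in>{1..r}. H j w' = H j w}" for w
  \<comment> \<open>One bin map is fixed per class, and each word uses the map of the class given by
    its own earlier labels.\<close>
  define hh where "hh G = (SOME h. Q G h)" for G
  have Q: "Q G (hh G)" if "G \<subseteq> A" "X r \<le> card G" for G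
  proof -
    have "card {w\<in>G. \<kappa> w = a} \<le> X (Suc r)" for a
    proof (cases "{w\<in>G. \<kappa> w = a} = {}")
      case True
      then show ?thesis using pos[of "Suc r"] by (simp only: card.empty)
    next
      case False
      then obtain w0 where w0: "w0 \<in> G" "\<kappa> w0 = a" by auto
      have "{w\<in>G. \<kappa> w = a} \<subseteq> fiber A (T (Suc r)) w0"
        using w0 that by (auto simp: \<kappa>_def fiber_def restrict_def fun_eq_iff) metis
      then have "card {w\<in>G. \<kappa> w = a} \<le> card (fiber A (T (Suc r)) w0)"
        by (intro card_mono finite_fiber fin)
      then show ?thesis using thin[of "Suc r" w0] w0 that Suc.prems by force
    qed
    moreover have "2 * real l * X (Suc r) \<le> card G" using that step[of r] Suc.prems by simp
    ultimately have "\<exists>h. Q G h"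
      unfolding Q_def using that fin pos by (intro bin_packing) (auto dest: finite_subset)
    then show ?thesis unfolding hh_def by (rule someI_ex)
  qed
  define H' where "H' j w = (if j = Suc r then hh (cls w) (\<kappa> w) else H j w)" for j w
  show ?case
  proof (intro exI[of _ H'] conjI ballI impI allI)
    fix j w w' assume j: "j \<in> {1..Suc r}" and w: "w \<in> A" "w' \<in> A" "\<forall>i\<in>T j. w i = w' i"
    show "H' j w = H' j w'"
    proof (cases "j = Suc r")
      case True
      have "H i w = H i w'" if "i \<in> {1..r}" for i
        using H(1)[OF that w(1,2)] w(3) True monoD[OF mono, of i "Suc r"] that by fastforce
      then have "cls w = cls w'" by (simp add: cls_def)
      moreover have "\<kappa> w = \<kappa> w'" using w(3) True by (auto simp: \<kappa>_def)
      ultimately show ?thesis using True by (simp add: H'_def)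
    next
      case False
      then show ?thesis using H(1)[of j w w'] j w by (auto simp: H'_def)
    qed
  next
    fix m assume m: "\<forall>j\<in>{1..Suc r}. m j \<in> {1..l}"
    define G where "G = {w\<in>A. \<forall>j\<in>{1..r}. H j w = m j}"
    have cls: "cls w = G" if "w \<in> G" for w using that by (auto simp: cls_def G_def)
    have "{w\<in>A. \<forall>j\<in>{1..Suc r}. H' j w = m j} = {w\<in>G. H' (Suc r) w = m (Suc r)}"
      by (auto simp: H'_def G_def le_Suc_eq)
    also have "\<dots> = {w\<in>G. hh G (\<kappa> w) = m (Suc r)}"
      using cls by (auto simp: H'_def)
    finally have "{w\<in>A. \<forall>j\<in>{1..Suc r}. H' j w = m j} = {w\<in>G. hh G (\<kappa> w) = m (Suc r)}" .
    moreover have "Q G (hh G)" using H(2)[of m] m by (intro Q) (auto simp: G_def)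
    ultimately show "X (Suc r) \<le> card {w\<in>A. \<forall>j\<in>{1..Suc r}. H' j w = m j}"
      using m by (simp add: Q_def)
  qed
qed

text \<open>Each class at the last stage holds at least \<open>X s > 0\<close> words, so every
  message tuple has a word to encode it.\<close>

lemma successive_labelling:
  fixes X :: "nat \<Rightarrow> real"
  assumes "finite A" and pos: "\<And>j. X j > 0"
    and "\<And>j w. j \<in> {1..s} \<Longrightarrow> w \<in> A \<Longrightarrow> card (fiber A (T j) w) \<le> X j"
    and "\<And>j. j < s \<Longrightarrow> 2 * real l * X (Suc j) \<le> X j"
    and "X 0 \<le> card A" and "mono T"
  shows "\<exists>H. (\<forall>j\<in>{1..s}. \<forall>w\<in>A. \<forall>w'\<in>A. (\<forall>i\<in>T j. w i = w' i) \<longrightarrow> H j w = (H j w' :: nat)) \<and>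
     (\<forall>m. (\<forall>j\<in>{1..s}. m j \<in> {1..l}) \<longrightarrow> (\<exists>w\<in>A. \<forall>j\<in>{1..s}. H j w = m j))"
proof -
  obtain H where H: "\<forall>j\<in>{1..s}. \<forall>w\<in>A. \<forall>w'\<in>A. (\<forall>i\<in>T j. w i = w' i) \<longrightarrow> H j w = (H j w' :: nat)"
     "\<And>m. (\<forall>j\<in>{1..s}. m j \<in> {1..l}) \<Longrightarrow> X s \<le> card {w\<in>A. \<forall>j\<in>{1..s}. H j w = m j}"
    using successive_labelling_aux[OF assms order_refl] by blast
  have "\<exists>w\<in>A. \<forall>j\<in>{1..s}. H j w = m j" if "\<forall>j\<in>{1..s}. m j \<in> {1..l}" for m
  proof -
    have "card {w\<in>A. \<forall>j\<in>{1..s}. H j w = m j} \<noteq> 0" using H(2)[OF that] pos[of s] by linarith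
    then show ?thesis by (metis (mono_tags, lifting) Collect_empty_eq card.empty)
  qed
  with H(1) show ?thesis by blast
qed

subsection \<open>Simulating weaker receivers\<close>

lemma prob_bind_pmf:
  "measure_pmf.prob (bind_pmf p f) E = measure_pmf.expectation p (\<lambda>x. measure_pmf.prob (f x) E)"
  unfolding measure_pmf_bind
  by (subst measure_pmf.measure_bind[where N = "count_space UNIV"])
     (auto simp: measurable_measure_pmf measure_pmf_in_subprob_space)

lemma integrable_pmf_prob [simp]: "integrable (measure_pmf p) (\<lambda>x. measure_pmf.prob (f x) E)"
  by (intro measure_pmf.integrable_const_bound[where B=1]) auto

lemma exists_le_expectation_pmf:
  fixes f :: "'a \<Rightarrow> real"
  assumes "integrable (measure_pmf p) f"
  shows "\<exists>x. f x \<le> measure_pmf.expectation p f"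
proof (rule ccontr)
  assume "\<not> ?thesis"
  then have lt: "\<And>x. measure_pmf.expectation p f < f x" by (simp add: not_le)
  have "measure_pmf.expectation p (\<lambda>_. measure_pmf.expectation p f) < measure_pmf.expectation p f"
    by (rule measure_pmf.integral_less_AE_space) (use assms lt in \<open>auto simp: measure_pmf.emeasure_space_1\<close>)
  then show False by simp
qed

text \<open>Drawing the selector \<open>s\<close> at random, independently at each point, gives equality on average.\<close>

lemma derandomise_kernel:
  fixes J :: "('m \<times> 'u) pmf" and Kn :: "'u \<Rightarrow> 'v pmf"
  assumes fin: "finite (snd ` set_pmf J)"
  shows "\<exists>s. measure_pmf.prob J {(m, u). (m, s u) \<in> E} \<le>
    measure_pmf.prob (bind_pmf J (\<lambda>(m, u). map_pmf (Pair m) (Kn u))) E"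
proof -
  define U where "U = snd ` set_pmf J"
  define P where "P = Pi_pmf U undefined Kn"
  have "bind_pmf J (\<lambda>(m, u). map_pmf (Pair m) (Kn u)) =
    bind_pmf J (\<lambda>(m, u). map_pmf (Pair m) (map_pmf (\<lambda>s. s u) P))"
    using fin by (intro bind_pmf_cong refl)
      (force simp: P_def U_def Pi_pmf_component[OF fin] split: prod.splits)
  also have "\<dots> = bind_pmf J (\<lambda>x. bind_pmf P (\<lambda>s. return_pmf (fst x, s (snd x))))"
    by (intro bind_pmf_cong refl) (auto simp: map_pmf_def bind_assoc_pmf bind_return_pmf)
  also have "\<dots> = bind_pmf P (\<lambda>s. map_pmf (\<lambda>x. (fst x, s (snd x))) J)"
    by (subst bind_commute_pmf) (simp add: map_pmf_def)
  finally have "measure_pmf.prob (bind_pmf J (\<lambda>(m, u). map_pmf (Pair m) (Kn u))) E =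
     measure_pmf.expectation P (\<lambda>s. measure_pmf.prob (map_pmf (\<lambda>x. (fst x, s (snd x))) J) E)"
    by (simp only: prob_bind_pmf)
  moreover obtain s where "measure_pmf.prob (map_pmf (\<lambda>x. (fst x, s (snd x))) J) E \<le>
      measure_pmf.expectation P (\<lambda>s. measure_pmf.prob (map_pmf (\<lambda>x. (fst x, s (snd x))) J) E)"
    using exists_le_expectation_pmf[OF integrable_pmf_prob,
      of "\<lambda>s. map_pmf (\<lambda>x. (fst x, s (snd x))) J" E P] by blast
  ultimately show ?thesis
    by (intro exI[of _ s]) (simp add: vimage_def case_prod_unfold)
qed

text \<open>
  \<open>weaker_kernel Q k y\<close> is the conditional law of \<open>(Y\<^sub>1, \<dots>, Y\<^sub>k)\<close> given \<open>Y\<^sub>k = y\<close>; it does not depend on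
  the channel input.
\<close>

primrec weaker_kernel :: "(nat \<Rightarrow> 'y \<Rightarrow> 'y pmf) \<Rightarrow> nat \<Rightarrow> 'y \<Rightarrow> (nat \<Rightarrow> 'y) pmf" where
  "weaker_kernel Q 0 y = return_pmf (\<lambda>_. undefined)"
| "weaker_kernel Q (Suc k) y = map_pmf (\<lambda>f. f(Suc k := y))
     (if k = 0 then return_pmf (\<lambda>_. undefined) else bind_pmf (Q k y) (weaker_kernel Q k))"

lemma weaker_kernel_support:
  "f \<in> set_pmf (weaker_kernel Q k y) \<Longrightarrow> f \<in> extensional {1..k} \<and> (k > 0 \<longrightarrow> f k = y)"
  by (induction k arbitrary: y f) (fastforce simp: extensional_def split: if_splits)+

text \<open>The intermediate value can be read off the result at coordinate \<open>k\<close>, so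
  only \<open>y = f k\<close> contributes to the mixture.\<close>

lemma pmf_bind_at_coordinate:
  assumes "\<And>y f. f \<in> set_pmf (Z y) \<Longrightarrow> f k = y"
  shows "pmf (bind_pmf p Z) f = pmf p (f k) * pmf (Z (f k)) f"
proof -
  have "pmf (Z y) f = pmf (Z (f k)) f * indicator {f k} y" for y
  proof (cases "y = f k")
    case False
    then have "f \<notin> set_pmf (Z y)" using assms by blast
    then show ?thesis using False by (simp add: pmf_eq_0_set_pmf)
  qed simp
  then have "pmf (bind_pmf p Z) f = measure_pmf.expectation p (\<lambda>y. pmf (Z (f k)) f * indicator {f k} y)"
    unfolding pmf_bind by (intro Bochner_Integration.integral_cong refl)
  also have "\<dots> = pmf (Z (f k)) f * pmf p (f k)"
    by (simp add: measure_pmf_single)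
  finally show ?thesis by simp
qed

text \<open>The product is the one in the definition of \<open>degraded\<close>; this identifies the
  recursive sampling with the Markov factorisation.\<close>

lemma pmf_weaker_kernel:
  assumes "k > 0" "f \<in> extensional {1..k}"
  shows "pmf (weaker_kernel Q k (f k)) f = (\<Prod>j\<in>{1..<k}. pmf (Q j (f (Suc j))) (f j))"
  using assms
proof (induction k arbitrary: f)
  case 0
  then show ?case by simp
next
  case (Suc k)
  define f' where "f' = f(Suc k := undefined)"
  define p where "p = (if k = 0 then return_pmf (\<lambda>_. undefined) else bind_pmf (Q k (f (Suc k))) (weaker_kernel Q k))"
  have f': "f' \<in> extensional {1..k}" using Suc.prems by (auto simp: f'_def extensional_def)
  have ext: "g (Suc k) = undefined" if "g \<in> set_pmf p" for g
    using that weaker_kernel_support[of g Q k] by (auto simp: p_def extensional_def split: if_splits)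
  have "pmf (weaker_kernel Q (Suc k) (f (Suc k))) f = pmf (map_pmf (\<lambda>g. g(Suc k := f (Suc k))) p) f"
    by (simp add: p_def)
  also have "\<dots> = measure_pmf.prob p ((\<lambda>g. g(Suc k := f (Suc k))) -` {f})"
    by (simp add: pmf_map)
  \<comment> \<open>On the support of \<open>p\<close> coordinate \<open>Suc k\<close> is
    \<open>undefined\<close>, so \<open>f'\<close> is the only preimage of \<open>f\<close> that can
    carry mass.\<close>
  also have "\<dots> = measure_pmf.prob p {f'}"
  proof (intro measure_prob_cong_0)
    fix g assume g: "g \<in> (\<lambda>g. g(Suc k := f (Suc k))) -` {f} - {f'}"
    have "g \<notin> set_pmf p"
    proof
      assume "g \<in> set_pmf p"
      then have "g (Suc k) = undefined" by (rule ext)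
      then have "g = f'" using g unfolding f'_def by (metis Diff_iff fun_upd_triv fun_upd_upd singletonD vimageE)
      then show False using g by simp
    qed
    then show "pmf p g = 0" by (simp add: pmf_eq_0_set_pmf)
  qed (auto simp: f'_def)
  also have "\<dots> = pmf p f'" by (simp add: measure_pmf_single)
  also have "\<dots> = (\<Prod>j\<in>{1..<Suc k}. pmf (Q j (f (Suc j))) (f j))"
  proof (cases "k = 0")
    case True
    then have "f' = (\<lambda>_. undefined)" using f' by (auto simp: extensional_def)
    then show ?thesis using True by (simp add: p_def)
  next
    case False
    have "pmf p f' = pmf (Q k (f (Suc k))) (f' k) * pmf (weaker_kernel Q k (f' k)) f'"
      unfolding p_def if_not_P[OF False]
      by (rule pmf_bind_at_coordinate) (use False weaker_kernel_support[of _ Q k] in auto)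
    also have "pmf (weaker_kernel Q k (f' k)) f' = (\<Prod>j\<in>{1..<k}. pmf (Q j (f' (Suc j))) (f' j))"
      using Suc.IH f' False by simp
    also have "\<dots> = (\<Prod>j\<in>{1..<k}. pmf (Q j (f (Suc j))) (f j))"
      by (intro prod.cong) (auto simp: f'_def)
    also have "f' k = f k" by (simp add: f'_def)
    finally show ?thesis using False by (simp add: atLeastLessThanSuc mult.commute)
  qed
  finally show ?case .
qed

text \<open>For \<open>k = K\<close> this is the assumed factorisation. The induction goes
  downwards: dropping coordinate \<open>Suc k\<close> turns the kernel from \<open>Suc k\<close>
  into one step of \<open>Q k\<close> followed by the kernel from \<open>k\<close>.\<close>

lemma degraded_kernel:
  fixes W :: "'x \<Rightarrow> (nat \<Rightarrow> 'y) pmf"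
  assumes "degraded W K"
  obtains Z :: "nat \<Rightarrow> 'y \<Rightarrow> (nat \<Rightarrow> 'y) pmf" where
    "\<And>k x. k \<in> {1..K} \<Longrightarrow>
       map_pmf (\<lambda>z. restrict z {1..k}) (W x) = bind_pmf (map_pmf (\<lambda>z. z k) (W x)) (Z k)"
proof -
  obtain Q :: "nat \<Rightarrow> 'y \<Rightarrow> 'y pmf" where Q: "\<And>x y. y \<in> extensional {1..K} \<Longrightarrow>
     pmf (map_pmf (\<lambda>z. restrict z {1..K}) (W x)) y =
     pmf (map_pmf (\<lambda>z. z K) (W x)) (y K) * (\<Prod>k\<in>{1..<K}. pmf (Q k (y (Suc k))) (y k))"
    using assms unfolding degraded_def by blast
  let ?Z = "weaker_kernel Q"
  have top: "map_pmf (\<lambda>z. restrict z {1..K}) (W x) = bind_pmf (map_pmf (\<lambda>z. z K) (W x)) (?Z K)"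
    if "K > 0" for x
  proof (rule pmf_eqI)
    fix y :: "nat \<Rightarrow> 'y"
    show "pmf (map_pmf (\<lambda>z. restrict z {1..K}) (W x)) y = pmf (bind_pmf (map_pmf (\<lambda>z. z K) (W x)) (?Z K)) y"
    proof (cases "y \<in> extensional {1..K}")
      case True
      have "pmf (bind_pmf (map_pmf (\<lambda>z. z K) (W x)) (?Z K)) y =
        pmf (map_pmf (\<lambda>z. z K) (W x)) (y K) * pmf (?Z K (y K)) y"
        by (rule pmf_bind_at_coordinate) (use that weaker_kernel_support[of _ Q K] in auto)
      then show ?thesis using Q[OF True] pmf_weaker_kernel[OF that True] by simp
    next
      case False
      then have "y \<notin> set_pmf (map_pmf (\<lambda>z. restrict z {1..K}) (W x))"
        "y \<notin> set_pmf (bind_pmf (map_pmf (\<lambda>z. z K) (W x)) (?Z K))"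
        using weaker_kernel_support[of y Q K] by auto
      then show ?thesis by (simp only: set_pmf_iff not_not)
    qed
  qed
  have "map_pmf (\<lambda>z. restrict z {1..k}) (W x) = bind_pmf (map_pmf (\<lambda>z. z k) (W x)) (?Z k)"
    if "k \<le> K" "1 \<le> k" for k x
    using that
  proof (induction k rule: inc_induct)
    case base
    then have "K > 0" by simp
    then show ?case by (rule top)
  next
    case (step k)
    \<comment> \<open>The output law of receiver \<open>Suc k\<close> pushed through
      \<open>Q k\<close>. Projecting to coordinate \<open>k\<close> shows below that it is the
      output law of receiver \<open>k\<close>.\<close>
    let ?p = "bind_pmf (map_pmf (\<lambda>z. z (Suc k)) (W x)) (Q k)"
    have rZ: "map_pmf (\<lambda>z. restrict z {1..k}) (?Z (Suc k) y) = bind_pmf (Q k y) (?Z k)" for y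
    proof -
      have "map_pmf (\<lambda>z. restrict z {1..k}) (?Z (Suc k) y) =
         map_pmf (\<lambda>f. restrict (f(Suc k := y)) {1..k}) (bind_pmf (Q k y) (?Z k))"
        using step.prems by (simp add: pmf.map_comp o_def)
      also have "\<dots> = map_pmf (\<lambda>f. f) (bind_pmf (Q k y) (?Z k))"
        using weaker_kernel_support[where Q=Q and k=k]
        by (intro map_pmf_cong refl) (force simp: extensional_def restrict_def fun_eq_iff)
      finally show ?thesis by simp
    qed
    have "map_pmf (\<lambda>z. restrict z {1..k}) (W x) =
      map_pmf (\<lambda>z. restrict z {1..k}) (map_pmf (\<lambda>z. restrict z {1..Suc k}) (W x))"
      by (auto simp: pmf.map_comp o_def restrict_def fun_eq_iff intro!: map_pmf_cong)
    also have "\<dots> = bind_pmf (map_pmf (\<lambda>z. z (Suc k)) (W x)) (\<lambda>y. bind_pmf (Q k y) (?Z k))"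
      by (subst step.IH) (use rZ in \<open>simp_all add: map_bind_pmf\<close>)
    finally have r: "map_pmf (\<lambda>z. restrict z {1..k}) (W x) = bind_pmf ?p (?Z k)"
      by (simp add: bind_assoc_pmf)
    have "map_pmf (\<lambda>z. z k) (W x) = map_pmf (\<lambda>z. z k) (map_pmf (\<lambda>z. restrict z {1..k}) (W x))"
      using step.prems by (simp add: pmf.map_comp o_def)
    also have "\<dots> = bind_pmf ?p (\<lambda>y. map_pmf (\<lambda>z. z k) (?Z k y))"
      unfolding r by (simp add: map_bind_pmf)
    also have "\<dots> = bind_pmf ?p return_pmf"
    proof (intro bind_pmf_cong refl)
      fix y
      have "map_pmf (\<lambda>z. z k) (?Z k y) = map_pmf (\<lambda>_. y) (?Z k y)"
        using weaker_kernel_support[of _ Q k y] step.prems by (intro map_pmf_cong) auto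
      then show "map_pmf (\<lambda>z. z k) (?Z k y) = return_pmf y" by simp
    qed
    finally have "map_pmf (\<lambda>z. z k) (W x) = ?p" by (simp add: bind_return_pmf')
    then show ?case by (simp only: r)
  qed
  then show ?thesis using that[of ?Z] by simp
qed

section \<open>Blocks of channel uses\<close>

lemma outputs_chan_n_in_PiE_dflt:
  fixes W :: "'x \<Rightarrow> (nat \<Rightarrow> 'y::finite) pmf"
  assumes "Y \<in> set_pmf (chan_n W n xs)"
  shows "(\<lambda>i. Y i k) \<in> PiE_dflt {..<n} (undefined k) (\<lambda>_. UNIV :: 'y set)"
  \<comment> \<open>Outside the block \<open>chan_n\<close> returns the function
    \<open>undefined\<close>, whose component \<open>k\<close> is
    \<open>undefined k\<close>.\<close>
  using assms set_Pi_pmf_subset[of "{..<n}"] unfolding chan_n_def PiE_dflt_def by fastforce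

text \<open>The channel is memoryless, so the one-letter identity may be applied at every time
  separately; products of laws commute with maps and binds once the default values are transported
  along.\<close>

lemma chan_n_kernel:
  assumes "\<And>x. map_pmf (\<lambda>z. restrict z {1..k}) (W x) = bind_pmf (map_pmf (\<lambda>z. z k) (W x)) Z"
  shows "map_pmf (\<lambda>Y i. restrict (Y i) {1..k}) (chan_n W n xs) =
    bind_pmf (map_pmf (\<lambda>Y i. Y i k) (chan_n W n xs))
      (\<lambda>u. Pi_pmf {..<n} (restrict undefined {1..k}) (\<lambda>i. Z (u i)))"
proof -
  have "map_pmf (\<lambda>Y i. restrict (Y i) {1..k}) (chan_n W n xs) =
     Pi_pmf {..<n} (restrict undefined {1..k}) (\<lambda>i. map_pmf (\<lambda>z. restrict z {1..k}) (W (xs i)))"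
    unfolding chan_n_def
    by (subst Pi_pmf_map[where dflt = undefined])
      (auto simp: fun_eq_iff intro!: map_pmf_cong)
  also have "\<dots> = Pi_pmf {..<n} (restrict undefined {1..k}) (\<lambda>i. bind_pmf (map_pmf (\<lambda>z. z k) (W (xs i))) Z)"
    by (simp only: assms)
  also have "\<dots> = bind_pmf (Pi_pmf {..<n} (undefined k) (\<lambda>i. map_pmf (\<lambda>z. z k) (W (xs i))))
      (\<lambda>u. Pi_pmf {..<n} (restrict undefined {1..k}) (\<lambda>i. Z (u i)))"
    by (subst Pi_pmf_bind[where d' = "undefined k"]) auto
  also have "Pi_pmf {..<n} (undefined k) (\<lambda>i. map_pmf (\<lambda>z. z k) (W (xs i))) =
      map_pmf (\<lambda>Y i. Y i k) (chan_n W n xs)"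
    unfolding chan_n_def
    by (subst Pi_pmf_map[where dflt = undefined])
      (auto simp: fun_eq_iff intro!: map_pmf_cong)
  finally show ?thesis .
qed

text \<open>Feeding the sequence of receiver \<open>k\<close> through the kernel reproduces the
  joint law of the message and the first \<open>k\<close> outputs. \<open>derandomise_kernel\<close>
  then freezes the simulation to a function \<open>s\<close>, chosen for the particular event
  \<open>E\<close>.\<close>

lemma degraded_decoder:
  fixes W :: "'x \<Rightarrow> (nat \<Rightarrow> 'y::finite) pmf"
  assumes "degraded W K" "k \<in> {1..K}"
  shows "\<exists>s. measure_pmf.prob (bind_pmf P (\<lambda>m. map_pmf (Pair m) (chan_n W n (F m))))
      {(m, Y). (m, s (\<lambda>i. Y i k)) \<in> E} \<le>
    measure_pmf.prob (bind_pmf P (\<lambda>m. map_pmf (Pair m) (chan_n W n (F m))))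
      {(m, Y). (m, \<lambda>i. restrict (Y i) {1..k}) \<in> E}"
proof -
  obtain Z where Z: "\<And>x. map_pmf (\<lambda>z. restrict z {1..k}) (W x) = bind_pmf (map_pmf (\<lambda>z. z k) (W x)) Z"
    using degraded_kernel[OF assms(1)] assms(2) by metis
  define Kn where "Kn u = Pi_pmf {..<n} (restrict undefined {1..k}) (\<lambda>i. Z (u i))" for u
  define J0 where "J0 = bind_pmf P (\<lambda>m. map_pmf (Pair m) (chan_n W n (F m)))"
  define J where "J = map_pmf (\<lambda>(m, Y). (m, \<lambda>i. Y i k)) J0"
  have "finite (snd ` set_pmf J)"
  proof (rule finite_subset)
    show "snd ` set_pmf J \<subseteq> PiE_dflt {..<n} (undefined k) (\<lambda>_. UNIV :: 'y set)"
      using outputs_chan_n_in_PiE_dflt by (fastforce simp: J_def J0_def)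
  qed (auto intro: finite_PiE_dflt)
  then obtain s where s: "measure_pmf.prob J {(m, u). (m, s u) \<in> E} \<le>
    measure_pmf.prob (bind_pmf J (\<lambda>(m, u). map_pmf (Pair m) (Kn u))) E"
    using derandomise_kernel by blast
  have "bind_pmf J (\<lambda>(m, u). map_pmf (Pair m) (Kn u)) =
    bind_pmf P (\<lambda>m. map_pmf (Pair m) (bind_pmf (map_pmf (\<lambda>Y i. Y i k) (chan_n W n (F m))) Kn))"
    by (simp add: J_def J0_def map_pmf_def bind_assoc_pmf bind_return_pmf)
  also have "\<dots> = bind_pmf P (\<lambda>m. map_pmf (Pair m) (map_pmf (\<lambda>Y i. restrict (Y i) {1..k}) (chan_n W n (F m))))"
    by (simp only: chan_n_kernel[of k W Z, OF Z] Kn_def[abs_def])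
  also have "\<dots> = map_pmf (\<lambda>(m, Y). (m, \<lambda>i. restrict (Y i) {1..k})) J0"
    by (simp add: J0_def map_bind_pmf pmf.map_comp o_def)
  finally show ?thesis using s unfolding J_def J0_def[symmetric]
    by (intro exI[of _ s]) (simp add: vimage_def case_prod_unfold)
qed

subsection \<open>Message sets and trivial bounds\<close>

lemma num_msgs_le: "real (num_msgs n R) \<le> 2 powr (real n * R)"
  unfolding num_msgs_def by (simp add: of_nat_nat)

lemma num_msgs_gt: "2 powr (real n * R) - 1 < real (num_msgs n R)"
  unfolding num_msgs_def by (simp add: of_nat_nat)

lemma num_msgs_ge_1:
  assumes "R \<ge> 0" shows "num_msgs n R \<ge> 1"
proof -
  have "2 powr (real n * R) \<ge> 1" using assms by (simp add: ge_one_powr_ge_zero)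
  then show ?thesis unfolding num_msgs_def by (simp add: le_nat_iff le_floor_iff)
qed

lemma num_msgs_0 [simp]: "num_msgs n 0 = 1"
  by (simp add: num_msgs_def)

lemma msg_pmf_eq:
  assumes "finite I" "L \<ge> 1"
  shows "msg_pmf I L = pmf_of_set (I \<rightarrow>\<^sub>E {1..L})"
proof -
  have "PiE_dflt I undefined (\<lambda>_. {1..L}) = (I \<rightarrow>\<^sub>E {1..L})"
    by (auto simp: PiE_dflt_def PiE_def extensional_def)
  then show ?thesis using assms unfolding msg_pmf_def
    by (subst Pi_pmf_of_set) auto
qed

lemma set_msg_pmf:
  assumes "finite I" "L \<ge> 1"
  shows "set_pmf (msg_pmf I L) = (I \<rightarrow>\<^sub>E {1..L})"
  unfolding msg_pmf_eq[OF assms] using assms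
  by (intro set_pmf_of_set) (auto simp: PiE_eq_empty_iff finite_PiE)

lemma cache_err_eq:
  assumes "L \<ge> 1"
  shows "cache_err W K D n L f g \<phi> d = (\<Sum>w\<in>{1..D} \<rightarrow>\<^sub>E {1..L}. measure_pmf.prob (chan_n W n (f d w))
    {Y. \<exists>k\<in>{1..K}. \<phi> k d (\<lambda>i. Y i k) (g k w) \<noteq> w (d k)}) / real (card ({1..D} \<rightarrow>\<^sub>E {1..L}))"
  unfolding cache_err_def prob_bind_pmf measure_map_pmf msg_pmf_eq[OF finite_atLeastAtMost assms] using assms
  by (subst integral_pmf_of_set) (auto simp: PiE_eq_empty_iff finite_PiE vimage_def)

section \<open>Rate zero, boundedness of rates, and expurgation\<close>

lemma sym_achievable_0:
  assumes "finite S" shows "sym_achievable W S 0"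
proof -
  have "sym_err W S n 1 f (\<lambda>_ _. 1) = 0" for n f
    unfolding sym_err_def measure_pmf_zero_iff using set_msg_pmf[OF assms order_refl]
    by (auto simp: PiE_def Pi_def)
  then show ?thesis unfolding sym_achievable_def num_msgs_0 by (metis order_refl)
qed

lemma cache_achievable_0:
  assumes "\<forall>k\<in>{1..K}. M k \<ge> 0"
  shows "cache_achievable W K D M 0"
proof -
  have "cache_err W K D n 1 f g (\<lambda>_ _ _ _. 1) d = 0" if "d \<in> {1..K} \<rightarrow>\<^sub>E {1..D}" for n f g d
    unfolding cache_err_def measure_pmf_zero_iff using set_msg_pmf[OF finite_atLeastAtMost order_refl, of 1 D] that
    by (fastforce simp: PiE_def Pi_def)
  moreover have "1 \<in> {1..num_msgs n (M k)}" if "k \<in> {1..K}" for n k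
    using num_msgs_ge_1 assms that by auto
  ultimately show ?thesis unfolding cache_achievable_def num_msgs_0
    by (intro conjI allI impI exI[of _ 0] exI[of _ "\<lambda>_ _ _. undefined"] exI[of _ "\<lambda>_ _. 1"] 
        exI[of _ "\<lambda>_ _ _ _. 1"]) auto
qed

text \<open>Receiver \<open>k\<close> sees at most \<open>CARD('y) ^ n\<close> sequences and so can
  name at most that many of the \<open>L\<close> equally likely messages.\<close>

lemma sym_err_lower_bound:
  fixes W :: "'x \<Rightarrow> (nat \<Rightarrow> 'y::finite) pmf"
  assumes S: "finite S" "k \<in> S" and L: "L \<ge> 1"
  shows "1 - real (CARD('y)) ^ n / real L \<le> sym_err W S n L f \<phi>"
proof -
  define J where "J = bind_pmf (msg_pmf S L) (\<lambda>w. map_pmf (\<lambda>Y. (w, Y)) (chan_n W n (f w)))"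
  define U where "U = PiE_dflt {..<n} (undefined k) (\<lambda>_. UNIV :: 'y set)"
  define E where "E = {(w, Y). \<exists>k\<in>S. \<phi> k (\<lambda>i. Y i k) \<noteq> w k}"
  define G where "G = {(w :: nat \<Rightarrow> nat, Y :: nat \<Rightarrow> nat \<Rightarrow> 'y). w k \<in> \<phi> k ` U}"
  have cU: "card U = CARD('y) ^ n" unfolding U_def by (subst card_PiE_dflt) auto
  have finU: "finite U" unfolding U_def by (intro finite_PiE_dflt) auto
  have "set_pmf J \<subseteq> E \<union> G"
  proof
    fix x assume "x \<in> set_pmf J"
    then obtain w Y where x: "x = (w, Y)" and "Y \<in> set_pmf (chan_n W n (f w))" by (auto simp: J_def)
    then have U: "(\<lambda>i. Y i k) \<in> U" unfolding U_def by (intro outputs_chan_n_in_PiE_dflt)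
    show "x \<in> E \<union> G"
    proof (cases "\<phi> k (\<lambda>i. Y i k) = w k")
      case True
      then have "w k \<in> \<phi> k ` U" using U by (metis imageI)
      then show ?thesis by (simp add: x G_def)
    next
      case False
      then show ?thesis using S(2) by (auto simp: x E_def)
    qed
  qed
  then have "measure_pmf.prob J (E \<union> G) = 1"
    by (subst measure_pmf.prob_eq_1) (auto simp: AE_measure_pmf_iff)
  then have 1: "1 \<le> measure_pmf.prob J E + measure_pmf.prob J G"
    using measure_Un_le[of E J G] by simp
  have "map_pmf (\<lambda>x. fst x k) J = map_pmf (\<lambda>w. w k) (msg_pmf S L)"
    by (simp add: J_def map_bind_pmf pmf.map_comp o_def map_pmf_def bind_assoc_pmf bind_return_pmf)
  also have "\<dots> = pmf_of_set {1..L}" unfolding msg_pmf_def using S by (simp add: Pi_pmf_component)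
  finally have "measure_pmf.prob J ((\<lambda>x. fst x k) -` (\<phi> k ` U)) = measure_pmf.prob (pmf_of_set {1..L}) (\<phi> k ` U)"
    by (metis measure_map_pmf)
  also have "(\<lambda>x. fst x k) -` (\<phi> k ` U) = G" by (auto simp: G_def)
  also have "measure_pmf.prob (pmf_of_set {1..L}) (\<phi> k ` U) = card ({1..L} \<inter> \<phi> k ` U) / L"
    using L by (subst measure_pmf_of_set) auto
  also have "\<dots> \<le> real (CARD('y)) ^ n / L"
  proof -
    have "card ({1..L} \<inter> \<phi> k ` U) \<le> card (\<phi> k ` U)" using finU by (intro card_mono) auto
    also have "\<dots> \<le> CARD('y) ^ n" using card_image_le[OF finU] cU by metis
    finally have "real (card ({1..L} \<inter> \<phi> k ` U)) \<le> real (CARD('y) ^ n)" by (simp only: of_nat_le_iff)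
    then show ?thesis by (intro divide_right_mono) auto
  qed
  finally show ?thesis using 1 by (simp add: sym_err_def J_def E_def)
qed

text \<open>A crude bound suffices: it makes the supremum in \<open>sym_capacity\<close> a genuine
  upper bound.\<close>

lemma sym_achievable_bounded:
  fixes W :: "'x \<Rightarrow> (nat \<Rightarrow> 'y::finite) pmf"
  assumes S: "finite S" "S \<noteq> {}" and R: "sym_achievable W S R"
  shows "R \<le> log 2 (4 * real (CARD('y)))"
proof -
  obtain k where k: "k \<in> S" using S by blast
  have R0: "R \<ge> 0" using R by (simp add: sym_achievable_def)
  obtain N where N: "\<forall>n\<ge>N. \<exists>(f :: (nat \<Rightarrow> nat) \<Rightarrow> nat \<Rightarrow> 'x) \<phi>. sym_err W S n (num_msgs n R) f \<phi> < 1/2"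
    using R unfolding sym_achievable_def by (meson half_gt_zero zero_less_one)
  define n where "n = Suc N"
  define L where "L = num_msgs n R"
  have L: "L \<ge> 1" using num_msgs_ge_1[OF R0] by (simp add: L_def)
  obtain f :: "(nat \<Rightarrow> nat) \<Rightarrow> nat \<Rightarrow> 'x" and \<phi> where "sym_err W S n L f \<phi> < 1/2"
    using N[rule_format, of n] by (auto simp: n_def L_def)
  then have "1 / 2 < real (CARD('y)) ^ n / real L"
    using sym_err_lower_bound[OF S(1) k L, where W=W and n=n and f=f and \<phi>=\<phi>] by linarith
  then have "real L < 2 * real (CARD('y)) ^ n" using L by (simp add: field_simps)
  moreover have "1 \<le> real (CARD('y)) ^ n" by (intro one_le_power) simp
  \<comment> \<open>The 4 absorbs the error level 1/2 and the rounding in \<open>num_msgs\<close>;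
    as \<open>n > 0\<close> it is at most \<open>4 ^ n\<close>.\<close>
  ultimately have "2 powr (real n * R) \<le> 4 * real (CARD('y)) ^ n"
    using num_msgs_gt[of n R] unfolding L_def by linarith
  also have "\<dots> \<le> 4 ^ n * real (CARD('y)) ^ n"
    by (intro mult_right_mono) (auto simp: n_def)
  also have "\<dots> = (4 * real (CARD('y))) powr real n" by (simp add: powr_realpow power_mult_distrib)
  also have "\<dots> = 2 powr (real n * log 2 (4 * real (CARD('y))))"
    by (simp add: powr_powr[symmetric] mult.commute[of "real n"])
  finally have "real n * R \<le> real n * log 2 (4 * real (CARD('y)))" by simp
  then show ?thesis by (simp add: n_def)
qed

text \<open>Markov's inequality applied to the sum of the errors over \<open>Q\<close>: its average
  is at most \<open>card Q * \<epsilon>\<close>, half the threshold, so at most half of the words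
  exceed the threshold for some \<open>d\<close>.\<close>

lemma expurgation:
  fixes e :: "'d \<Rightarrow> 'w \<Rightarrow> real" and \<epsilon> :: real
  assumes fin: "finite \<Omega>" "\<Omega> \<noteq> {}" "finite Q" "Q \<noteq> {}" and \<epsilon>: "\<epsilon> > 0"
    and nonneg: "\<And>d w. e d w \<ge> 0"
    and avg: "\<And>d. d \<in> Q \<Longrightarrow> (\<Sum>w\<in>\<Omega>. e d w) / card \<Omega> < \<epsilon>"
  shows "card \<Omega> \<le> 2 * card {w\<in>\<Omega>. \<forall>d\<in>Q. e d w \<le> 2 * real (card Q) * \<epsilon>}"
proof -
  define t :: real where "t = 2 * real (card Q) * \<epsilon>"
  define G where "G = {w\<in>\<Omega>. \<forall>d\<in>Q. e d w \<le> t}"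
  have Q0: "card Q > 0" and \<Omega>0: "card \<Omega> > 0" using fin by (auto simp: card_gt_0_iff)
  have t0: "t > 0" using Q0 \<epsilon> by (simp add: t_def)
  have "real (card (\<Omega> - G)) * t = (\<Sum>w\<in>\<Omega> - G. (t :: real))" by simp
  also have "\<dots> \<le> (\<Sum>w\<in>\<Omega> - G. \<Sum>d\<in>Q. e d w)"
  proof (rule sum_mono)
    fix w assume "w \<in> \<Omega> - G"
    then obtain d where d: "d \<in> Q" "t < e d w" by (auto simp: G_def not_le)
    then show "t \<le> (\<Sum>d\<in>Q. e d w)"
      using member_le_sum[of d Q "\<lambda>d. e d w"] nonneg fin by fastforce
  qed
  also have "\<dots> \<le> (\<Sum>w\<in>\<Omega>. \<Sum>d\<in>Q. e d w)"
    using fin nonneg by (intro sum_mono2) (auto intro: sum_nonneg)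
  also have "\<dots> = (\<Sum>d\<in>Q. \<Sum>w\<in>\<Omega>. e d w)" by (rule sum.swap)
  also have "\<dots> \<le> (\<Sum>d\<in>Q. \<epsilon> * card \<Omega>)"
    using avg \<Omega>0 by (intro sum_mono) (simp add: field_simps less_imp_le)
  also have "\<dots> = (card \<Omega> / 2) * t" by (simp add: t_def)
  finally have "2 * card (\<Omega> - G) \<le> card \<Omega>" using t0 by (simp add: mult_le_cancel_right)
  moreover have "card (\<Omega> - G) = card \<Omega> - card G" "card G \<le> card \<Omega>"
    using fin by (auto simp: G_def intro: card_Diff_subset card_mono)
  ultimately have "card \<Omega> \<le> 2 * card G" by linarith
  then show ?thesis by (simp add: G_def t_def)
qed

subsection \<open>From cache codes to codes without caches\<close>

text \<open>In the size condition the leading 2 pays for expurgation and the product for fixing the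
  cache contents. Inside the power, the 2 pays for bin packing and \<open>D ^ D\<close> for
  peeling.\<close>

lemma sym_code_of_cache_code:
  fixes W :: "'x \<Rightarrow> (nat \<Rightarrow> 'y::finite) pmf" and V :: "nat \<Rightarrow> nat" and \<epsilon> :: real
  assumes deg: "degraded W K" and K: "K \<le> D" and S: "S \<subseteq> {1..K}" "S \<noteq> {}"
    and L: "L \<ge> 1" and l: "l \<ge> 1" and \<epsilon>: "\<epsilon> > 0"
    and range: "\<And>k w. k \<in> {1..K} \<Longrightarrow> w \<in> set_pmf (msg_pmf {1..D} L) \<Longrightarrow> g k w \<in> {1..V k}"
    and err: "\<And>d. d \<in> {1..K} \<rightarrow>\<^sub>E {1..D} \<Longrightarrow> cache_err W K D n L f g \<phi> d < \<epsilon>"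
    and size: "2 * real (\<Prod>k\<in>S. V k) * (2 * real D ^ D * real l) ^ D \<le> real L ^ D"
  shows "\<exists>F \<psi>. sym_err W S n l F \<psi> \<le> real K * (2 * real (D ^ K) * \<epsilon>)"
proof -
  define \<Omega> where "\<Omega> = ({1..D} \<rightarrow>\<^sub>E {1..L})"
  define Dem where "Dem = ({1..K} \<rightarrow>\<^sub>E {1..D})"
  define e where "e d w = measure_pmf.prob (chan_n W n (f d w))
    {Y. \<exists>k\<in>{1..K}. \<phi> k d (\<lambda>i. Y i k) (g k w) \<noteq> w (d k)}" for d w
  define t where "t = 2 * real (D ^ K) * \<epsilon>"
  have finS: "finite S" using S finite_subset by blast
  have "card S \<le> K" using card_mono[OF _ S(1)] by simp
  have D1: "D \<ge> 1" using S K by force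
  have fin\<Omega>: "finite \<Omega>" and \<Omega>0: "\<Omega> \<noteq> {}" and c\<Omega>: "card \<Omega> = L ^ D"
    using L by (auto simp: \<Omega>_def finite_PiE PiE_eq_empty_iff card_PiE)
  have finDem: "finite Dem" and Dem0: "Dem \<noteq> {}" and cDem: "card Dem = D ^ K"
    using D1 by (auto simp: Dem_def finite_PiE PiE_eq_empty_iff card_PiE)
  have t0: "t \<ge> 0" using \<epsilon> by (simp add: t_def)

  \<comment> \<open>All demand vectors are handled at once, since the one used later depends on how
    the surviving set peels.\<close>
  define A0 where "A0 = {w\<in>\<Omega>. \<forall>d\<in>Dem. e d w \<le> t}"
  have A0: "card \<Omega> \<le> 2 * card A0"
    unfolding A0_def t_def cDem[symmetric]
  proof (rule expurgation)
    show "(\<Sum>w\<in>\<Omega>. e d w) / card \<Omega> < \<epsilon>" if "d \<in> Dem" for d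
      using err[of d] that unfolding cache_err_eq[OF L] by (simp add: \<Omega>_def Dem_def e_def)
  qed (use fin\<Omega> \<Omega>0 finDem Dem0 \<epsilon> in \<open>auto simp: e_def\<close>)

  define C where "C = (\<Pi>\<^sub>E k\<in>S. {1..V k})"
  have cC: "card C = (\<Prod>k\<in>S. V k)" using finS by (simp add: C_def card_PiE)
  define \<kappa> where "\<kappa> w = (\<lambda>k\<in>S. g k w)" for w
  have \<kappa>C: "\<kappa> w \<in> C" if "w \<in> \<Omega>" for w
    using range that S set_msg_pmf[of "{1..D}" L] L unfolding \<kappa>_def C_def \<Omega>_def
    by (intro restrict_PiE_iff[THEN iffD2]) blast
  have finC: "finite C" using finS by (auto simp: C_def intro: finite_PiE)
  have C0: "C \<noteq> {}" using \<kappa>C \<Omega>0 by blast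
  \<comment> \<open>Fixing one frequent content \<open>v\<close> turns the caches into constants
    that every decoder may use.\<close>
  obtain v where v: "card A0 \<le> card C * card {w\<in>A0. \<kappa> w = v}"
    using pigeonhole_card_class[OF finC C0, of \<kappa> A0] \<kappa>C by (auto simp: A0_def)
  define A where "A = {w\<in>A0. \<kappa> w = v}"
  have A\<Omega>: "A \<subseteq> \<Omega>" by (auto simp: A_def A0_def)
  have finA: "finite A" using A\<Omega> fin\<Omega> finite_subset by blast
  have gv: "g k w = v k" if "w \<in> A" "k \<in> S" for w k
    using that by (auto simp: A_def \<kappa>_def)
  have eA: "e d w \<le> t" if "w \<in> A" "d \<in> Dem" for d w
    using that by (auto simp: A_def A0_def)
  have "L ^ D \<le> 2 * (card C * card A)"
    using A0 v c\<Omega> by (simp add: A_def)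
  then have "real (L ^ D) \<le> real (2 * (card C * card A))" by (simp only: of_nat_le_iff)
  then have "2 * real (card C) * (2 * real D ^ D * real l) ^ D \<le> 2 * real (card C) * real (card A)"
    using size by (simp add: cC)
  moreover have "card C > 0" using finC C0 by (simp add: card_gt_0_iff)
  ultimately have sizeA: "(2 * real D ^ D * real l) ^ D \<le> real (card A)"
    by (simp add: mult_le_cancel_left_pos)

  \<comment> \<open>With this \<open>c\<close> the size condition of \<open>peel_ordering\<close> is
    an equality, and \<open>size\<close> becomes \<open>2 * D ^ D * l\<close> at most
    \<open>c\<close>.\<close>
  define c where "c = root D (card A)"
  have cD: "c ^ D = card A" using D1 by (simp add: c_def)
  have c0: "c \<ge> 0" by (simp add: c_def real_root_ge_zero)
  have lc: "2 * real D ^ D * real l \<le> c"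
    using sizeA D1 c0 by (simp flip: cD add: power_mono_iff)
  have DD: "real D ^ D \<ge> 1" using D1 by (simp add: one_le_power)
  have "2 * real D ^ D * real l > 0" using D1 l by simp
  then have cpos: "c > 0" using lc by linarith
  obtain ds B where ds: "distinct ds" "set ds = {1..D}" and BA: "B \<subseteq> A" and cB: "card A \<le> D ^ D * card B"
    and thin: "\<And>j w. j \<le> D \<Longrightarrow> w \<in> B \<Longrightarrow> card (fiber B (set (take j ds)) w) \<le> c ^ (D - j)"
  proof (rule peel_ordering[of A "{1..D}" c])
    show "A \<subseteq> extensional {1..D}" using A\<Omega> by (auto simp: \<Omega>_def PiE_def)
  qed (use finA cD c0 in auto)
  have finB: "finite B" using BA finA finite_subset by blast

  define s where "s = card S"
  have sD: "s \<le> D" using \<open>card S \<le> K\<close> K by (simp add: s_def)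
  \<comment> \<open>\<open>X 0\<close> is \<open>card B\<close> and not \<open>c ^ D\<close>,
    because peeling may have lost a factor \<open>D ^ D\<close>. Only the first labelling step needs
    that factor in \<open>c\<close>; the later ones use just \<open>2 * l\<close> at most
    \<open>c\<close>.\<close>
  define X :: "nat \<Rightarrow> real" where "X j = (if j = 0 then card B else c ^ (D - j))" for j
  define T where "T j = set (take j ds)" for j
  have B0: "card B > 0"
  proof (rule ccontr)
    assume "\<not> ?thesis"
    then have "card A = 0" using cB by simp
    then show False using cD cpos by simp
  qed
  have step: "2 * real l * X (Suc j) \<le> X j" if j: "j < s" for j
  proof (cases "j = 0")
    case True
    have "real D ^ D * (2 * real l * c ^ (D - 1)) = (2 * real D ^ D * real l) * c ^ (D - 1)" by simp
    also have "\<dots> \<le> c * c ^ (D - 1)" using lc c0 by (intro mult_right_mono) auto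
    also have "\<dots> = card A" using D1 cD by (simp flip: power_Suc)
    also have "\<dots> \<le> real (D ^ D * card B)" using cB by (simp only: of_nat_le_iff)
    also have "\<dots> = real D ^ D * real (card B)" by simp
    finally have "2 * real l * c ^ (D - 1) \<le> card B" using D1 by (simp add: mult_le_cancel_left)
    then show ?thesis using True by (simp add: X_def)
  next
    case False
    have "2 * real l * 1 \<le> 2 * real l * real D ^ D" using DD by (intro mult_left_mono) auto
    then have "2 * real l \<le> c" using lc by (simp add: mult_ac)
    then have "2 * real l * c ^ (D - Suc j) \<le> c * c ^ (D - Suc j)"
      using c0 by (intro mult_right_mono) auto
    also have "\<dots> = c ^ (D - j)" using j sD by (simp flip: power_Suc add: Suc_diff_Suc)
    finally show ?thesis using False by (simp add: X_def)
  qed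
  have Xpos: "X j > 0" for j using B0 cpos by (simp add: X_def)
  have thinX: "real (card (fiber B (T j) w)) \<le> X j" if "j \<in> {1..s}" "w \<in> B" for j w
    using thin[of j w] that sD by (simp add: X_def T_def)
  have X0: "X 0 \<le> card B" by (simp add: X_def)
  have monoT: "mono T" unfolding T_def by (intro monoI set_take_subset_set_take)
  obtain H where H: "\<forall>j\<in>{1..s}. \<forall>w\<in>B. \<forall>w'\<in>B. (\<forall>i\<in>T j. w i = w' i) \<longrightarrow> H j w = (H j w' :: nat)"
    "\<forall>m. (\<forall>j\<in>{1..s}. m j \<in> {1..l}) \<longrightarrow> (\<exists>w\<in>B. \<forall>j\<in>{1..s}. H j w = m j)"
    using successive_labelling[OF finB Xpos thinX step X0 monoT] by blast

  define ks where "ks = sorted_list_of_set S"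
  have ks: "sorted ks" "distinct ks" "set ks = S" "length ks = s"
    using finS by (simp_all add: ks_def s_def)
  have "\<exists>q<s. ks ! q = k" if "k \<in> S" for k using that ks by (metis in_set_conv_nth)
  \<comment> \<open>Ranks start at 0 with the weakest receiver and labels at 1, so receiver
    \<open>k\<close> is to recover label \<open>Suc (rk k)\<close>, a function of the first
    \<open>Suc (rk k)\<close> files of \<open>ds\<close>.\<close>
  then obtain rk where rk: "\<And>k. k \<in> S \<Longrightarrow> rk k < s \<and> ks ! rk k = k" by metis
  have rk_nth: "rk (ks ! q) = q" if "q < s" for q
    using that rk[of "ks ! q"] ks by (metis nth_eq_iff_index_eq nth_mem)
  have lds: "length ds = D" using ds by (metis card_atLeastAtMost diff_Suc_1 distinct_card)
  \<comment> \<open>Receivers in \<open>S\<close> demand distinct files in the peeled order; outside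
    \<open>S\<close> any valid file will do.\<close>
  define d where "d = (\<lambda>k\<in>{1..K}. if k \<in> S then ds ! rk k else 1)"
  have dDem: "d \<in> Dem"
  proof -
    have "ds ! rk k \<in> {1..D}" if "k \<in> S" for k
      using rk[OF that] sD lds ds(2) by (metis nth_mem order_less_le_trans)
    then show ?thesis using D1 by (auto simp: Dem_def d_def)
  qed
  have dS: "d k = ds ! rk k" if "k \<in> S" for k using that S by (auto simp: d_def)
  define enc where "enc m = (SOME w. w \<in> B \<and> (\<forall>j\<in>{1..s}. H j w = m (ks ! (j - 1))))" for m
  have enc: "enc m \<in> B" "\<And>k. k \<in> S \<Longrightarrow> H (Suc (rk k)) (enc m) = m k"
    if m: "m \<in> S \<rightarrow>\<^sub>E {1..l}" for m
  proof -
    have "\<forall>j\<in>{1..s}. m (ks ! (j - 1)) \<in> {1..l}"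
    proof
      fix j assume "j \<in> {1..s}"
      then have "ks ! (j - 1) \<in> S" using nth_mem[of "j - 1" ks] ks by force
      then show "m (ks ! (j - 1)) \<in> {1..l}" using m by auto
    qed
    then have "\<exists>w. w \<in> B \<and> (\<forall>j\<in>{1..s}. H j w = m (ks ! (j - 1)))"
      using H(2)[rule_format, of "\<lambda>j. m (ks ! (j - 1))"] by blast
    then have *: "enc m \<in> B \<and> (\<forall>j\<in>{1..s}. H j (enc m) = m (ks ! (j - 1)))"
      unfolding enc_def by (rule someI_ex)
    then show "enc m \<in> B" by blast
    fix k assume k: "k \<in> S"
    then have "Suc (rk k) \<in> {1..s}" using rk by (simp add: Suc_leI)
    then show "H (Suc (rk k)) (enc m) = m k" using * rk[OF k] by force
  qed
  \<comment> \<open>Given outputs of receivers up to \<open>k\<close>, the decoder picks any word of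
    \<open>B\<close> consistent with all their file decisions. This word may differ from the encoded
    one, but it agrees with it on the files that determine label \<open>Suc (rk k)\<close>.\<close>
  define dec where "dec k Z = H (Suc (rk k))
    (SOME w. w \<in> B \<and> (\<forall>k'\<in>S. k' \<le> k \<longrightarrow> \<phi> k' d (\<lambda>i. Z i k') (v k') = w (d k')))" for k Z
  have dec: "dec k (\<lambda>i. restrict (Y i) {1..k}) = m k"
    if m: "m \<in> S \<rightarrow>\<^sub>E {1..l}" and k: "k \<in> S"
      and ok: "\<forall>k\<in>{1..K}. \<phi> k d (\<lambda>i. Y i k) (g k (enc m)) = enc m (d k)" for k m Y
  proof -
    define Pr where "Pr w \<longleftrightarrow> w \<in> B \<and>
      (\<forall>k'\<in>S. k' \<le> k \<longrightarrow> \<phi> k' d (\<lambda>i. restrict (Y i) {1..k} k') (v k') = w (d k'))" for w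
    have eq: "(\<lambda>i. restrict (Y i) {1..k} k') = (\<lambda>i. Y i k')" if "k' \<in> S" "k' \<le> k" for k'
      using that S by auto
    have P: "Pr (enc m)"
      unfolding Pr_def
    proof (intro conjI ballI impI)
      fix k' assume k': "k' \<in> S" "k' \<le> k"
      then have "g k' (enc m) = v k'" using gv enc(1)[OF m] BA by blast
      then show "\<phi> k' d (\<lambda>i. restrict (Y i) {1..k} k') (v k') = enc m (d k')"
        unfolding eq[OF k'] using ok k' S by force
    qed (rule enc(1)[OF m])
    then have P': "Pr (SOME w. Pr w)" by (rule someI[of Pr])
    define w' where "w' = (SOME w. Pr w)"
    \<comment> \<open>Each such file is demanded by some receiver of \<open>S\<close> no stronger
      than \<open>k\<close>, and both words match the decision of that receiver.\<close>
    have "w' i = enc m i" if i: "i \<in> T (Suc (rk k))" for i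
    proof -
      obtain q where q: "q \<le> rk k" "i = ds ! q"
        using i unfolding T_def in_set_conv_nth by (auto simp: less_Suc_eq_le)
      define k' where "k' = ks ! q"
      have qs: "q < s" using q rk[OF k] by linarith
      then have k': "k' \<in> S" unfolding k'_def using ks by (metis nth_mem)
      have "k' \<le> ks ! rk k" unfolding k'_def using ks q rk[OF k] by (intro sorted_nth_mono) auto
      then have "k' \<le> k" using rk[OF k] by simp
      moreover have "d k' = i" using dS[OF k'] rk_nth[OF qs] q by (simp add: k'_def)
      moreover have "Pr w'" using P' by (simp only: w'_def)
      ultimately show ?thesis using P k' unfolding Pr_def by auto
    qed
    then have "H (Suc (rk k)) w' = H (Suc (rk k)) (enc m)"
      using rk[OF k] P' enc(1)[OF m] by (intro H(1)[rule_format]) (auto simp: w'_def Pr_def Suc_leI)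
    then show ?thesis using enc(2)[OF m k] unfolding dec_def w'_def Pr_def by simp
  qed

  define F where "F m = f d (enc m)" for m
  define J where "J = bind_pmf (msg_pmf S l) (\<lambda>m. map_pmf (Pair m) (chan_n W n (F m)))"
  \<comment> \<open>Here receiver \<open>k\<close> still sees the true outputs of all weaker
    receivers. The words \<open>enc m\<close> need not be uniform in the library, so an average
    error would not help; after expurgation \<open>t\<close> bounds the error of each word of
    \<open>A\<close>.\<close>
  have joint: "measure_pmf.prob J {(m, Y). dec k (\<lambda>i. restrict (Y i) {1..k}) \<noteq> m k} \<le> t"
    if k: "k \<in> S" for k
  proof -
    have "measure_pmf.prob J {(m, Y). dec k (\<lambda>i. restrict (Y i) {1..k}) \<noteq> m k} =
      measure_pmf.expectation (msg_pmf S l) (\<lambda>m. measure_pmf.prob (chan_n W n (F m))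
        {Y. dec k (\<lambda>i. restrict (Y i) {1..k}) \<noteq> m k})"
      unfolding J_def prob_bind_pmf measure_map_pmf by (simp add: vimage_def)
    also have "\<dots> \<le> t"
    proof (rule measure_pmf.integral_le_const)
      show "AE m in measure_pmf (msg_pmf S l). measure_pmf.prob (chan_n W n (F m))
        {Y. dec k (\<lambda>i. restrict (Y i) {1..k}) \<noteq> m k} \<le> t"
        unfolding AE_measure_pmf_iff set_msg_pmf[OF finS l]
      proof
        fix m assume m: "m \<in> S \<rightarrow>\<^sub>E {1..l}"
        have "measure_pmf.prob (chan_n W n (F m)) {Y. dec k (\<lambda>i. restrict (Y i) {1..k}) \<noteq> m k} \<le> e d (enc m)"
          unfolding e_def F_def using dec[OF m k]
          by (intro measure_pmf.finite_measure_mono) auto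
        also have "\<dots> \<le> t" using enc(1)[OF m] BA dDem by (intro eA) auto
        finally show "measure_pmf.prob (chan_n W n (F m)) {Y. dec k (\<lambda>i. restrict (Y i) {1..k}) \<noteq> m k} \<le> t" .
      qed
    qed (rule measure_pmf.integrable_const_bound[where B=1], auto)
    finally show ?thesis .
  qed
  have "\<exists>u. measure_pmf.prob J {(m, Y). dec k (u (\<lambda>i. Y i k)) \<noteq> m k} \<le> t" if k: "k \<in> S" for k
  proof -
    have "k \<in> {1..K}" using k S by blast
    then obtain u where "measure_pmf.prob J {(m, Y). (m, u (\<lambda>i. Y i k)) \<in> {(m, Z). dec k Z \<noteq> m k}} \<le>
       measure_pmf.prob J {(m, Y). (m, \<lambda>i. restrict (Y i) {1..k}) \<in> {(m, Z). dec k Z \<noteq> m k}}"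
      using degraded_decoder[OF deg, of k "msg_pmf S l" n F "{(m, Z). dec k Z \<noteq> m k}"]
      unfolding J_def by blast
    then show ?thesis using joint[OF k] by (intro exI[of _ u]) simp
  qed
  then obtain u where u: "\<And>k. k \<in> S \<Longrightarrow> measure_pmf.prob J {(m, Y). dec k (u k (\<lambda>i. Y i k)) \<noteq> m k} \<le> t"
    by metis
  \<comment> \<open>The simulations \<open>u k\<close> were chosen separately for each receiver,
    which is enough for a union bound.\<close>
  have "sym_err W S n l F (\<lambda>k y. dec k (u k y)) =
     measure_pmf.prob J (\<Union>k\<in>S. {(m, Y). dec k (u k (\<lambda>i. Y i k)) \<noteq> m k})"
    unfolding sym_err_def J_def by (intro arg_cong2[where f=measure]) auto
  also have "\<dots> \<le> (\<Sum>k\<in>S. measure_pmf.prob J {(m, Y). dec k (u k (\<lambda>i. Y i k)) \<noteq> m k})"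
    using finS by (intro measure_UNION_le) auto
  also have "\<dots> \<le> (\<Sum>k\<in>S. t)" using u by (intro sum_mono)
  also have "\<dots> = real (card S) * t" by simp
  also have "\<dots> \<le> real K * t" using \<open>card S \<le> K\<close> t0 by (intro mult_right_mono) auto
  finally show ?thesis unfolding t_def by blast
qed

text \<open>Apart from the cache contents, the losses in the conversion are constant in
  \<open>n\<close>, so any positive rate gap covers them for long blocks. The exponent
  \<open>D\<close> in the size condition spreads the total cache rate over \<open>D\<close>
  files.\<close>

lemma sym_achievable_of_cache_achievable:
  fixes W :: "'x \<Rightarrow> (nat \<Rightarrow> 'y::finite) pmf"
  assumes deg: "degraded W K" and K: "K \<le> D" and S: "S \<subseteq> {1..K}" "S \<noteq> {}"
    and M: "\<forall>k\<in>{1..K}. M k \<ge> 0"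
    and R: "cache_achievable W K D M R"
    and r: "r \<ge> 0" "r < R - (\<Sum>k\<in>S. M k) / real D"
  shows "sym_achievable W S r"
  unfolding sym_achievable_def
proof (intro conjI allI impI)
  fix \<epsilon> :: real assume \<epsilon>: "\<epsilon> > 0"
  define MS where "MS = (\<Sum>k\<in>S. M k)"
  have finS: "finite S" using S finite_subset by blast
  have K1: "K \<ge> 1" using S by force
  then have D1: "D \<ge> 1" using K by simp
  have MS0: "MS \<ge> 0" unfolding MS_def using M S by (intro sum_nonneg) auto
  define \<delta> where "\<delta> = R - MS / D - r"
  have \<delta>: "\<delta> > 0" using r by (simp add: \<delta>_def MS_def)
  have R0: "R > 0" using r MS0 D1 by (smt (verit) MS_def divide_nonneg_nonneg of_nat_0_le_iff)
  \<comment> \<open>Chosen so that the error bound of the conversion becomes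
    \<open>\<epsilon> / 2\<close>.\<close>
  define \<epsilon>' where "\<epsilon>' = \<epsilon> / (4 * real K * real (D ^ K))"
  have \<epsilon>': "\<epsilon>' > 0" using \<epsilon> K1 D1 by (simp add: \<epsilon>'_def)
  have \<epsilon>'\<epsilon>: "real K * (2 * real (D ^ K) * \<epsilon>') < \<epsilon>"
    using \<epsilon> K1 D1 by (simp add: \<epsilon>'_def field_simps)
  obtain N where N: "\<And>n. n \<ge> N \<Longrightarrow> \<exists>(f :: (nat \<Rightarrow> nat) \<Rightarrow> (nat \<Rightarrow> nat) \<Rightarrow> nat \<Rightarrow> 'x) g \<phi>.
        (\<forall>k\<in>{1..K}. \<forall>w\<in>set_pmf (msg_pmf {1..D} (num_msgs n R)). g k w \<in> {1..num_msgs n (M k)}) \<and>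
        (\<forall>d \<in> {1..K} \<rightarrow>\<^sub>E {1..D}. cache_err W K D n (num_msgs n R) f g \<phi> d < \<epsilon>')"
    using R \<epsilon>' unfolding cache_achievable_def by blast
  \<comment> \<open>Beyond \<open>N\<close> there are codes; the second bound gives
    \<open>n * R\<close> at least 1, so rounding costs at most a factor 2; the third makes
    \<open>2 powr (n * \<delta>)\<close> at least \<open>8 * D ^ D\<close>.\<close>
  define N' where "N' = max N (max (nat \<lceil>1 / R\<rceil>) (nat \<lceil>log 2 (8 * real D ^ D) / \<delta>\<rceil>))"
  show "\<exists>N. \<forall>n\<ge>N. \<exists>(f :: (nat \<Rightarrow> nat) \<Rightarrow> nat \<Rightarrow> 'x) \<phi>. sym_err W S n (num_msgs n r) f \<phi> < \<epsilon>"
  proof (intro exI[of _ N'] allI impI)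
    fix n assume n: "n \<ge> N'"
    have n1: "n \<ge> N" and "real n \<ge> 1 / R" and "real n \<ge> log 2 (8 * real D ^ D) / \<delta>"
      using n by (auto simp: N'_def nat_le_iff ceiling_le_iff)
    then have nR: "real n * R \<ge> 1" and n\<delta>: "real n * \<delta> \<ge> log 2 (8 * real D ^ D)"
      using R0 \<delta> by (auto simp: field_simps)
    obtain f :: "(nat \<Rightarrow> nat) \<Rightarrow> (nat \<Rightarrow> nat) \<Rightarrow> nat \<Rightarrow> 'x" and g \<phi> where code:
        "\<forall>k\<in>{1..K}. \<forall>w\<in>set_pmf (msg_pmf {1..D} (num_msgs n R)). g k w \<in> {1..num_msgs n (M k)}"
        "\<forall>d \<in> {1..K} \<rightarrow>\<^sub>E {1..D}. cache_err W K D n (num_msgs n R) f g \<phi> d < \<epsilon>'"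
      using N[OF n1] by blast
    have DDpos: "8 * real D ^ D > 0" using D1 by simp
    have big: "8 * real D ^ D \<le> 2 powr (real n * \<delta>)"
      using n\<delta> DDpos by (simp add: log_le_iff)
    have half: "2 powr (real n * R) / 2 \<le> num_msgs n R"
    proof -
      have "2 powr 1 \<le> 2 powr (real n * R)" using nR by (intro powr_mono) auto
      then show ?thesis using num_msgs_gt[of n R] by simp
    qed
    \<comment> \<open>The leading 2 is enlarged to \<open>2 ^ D\<close> to make everything a power
      with exponent \<open>D\<close>. Each factor then carries \<open>4 * D ^ D\<close>, written as
      \<open>8 * D ^ D / 2\<close> to leave the half lost by rounding the library size.\<close>
    have "2 * real (\<Prod>k\<in>S. num_msgs n (M k)) * (2 * real D ^ D * real (num_msgs n r)) ^ D \<le>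
       2 ^ D * 2 powr (real n * MS) * (2 * real D ^ D * 2 powr (real n * r)) ^ D"
    proof (intro mult_mono power_mono)
      show "(2 :: real) \<le> 2 ^ D" using D1 power_increasing[of 1 D "2 :: real"] by simp
      have "real (\<Prod>k\<in>S. num_msgs n (M k)) \<le> (\<Prod>k\<in>S. 2 powr (real n * M k))"
        unfolding of_nat_prod by (intro prod_mono) (auto simp: num_msgs_le)
      also have "\<dots> = 2 powr (real n * MS)"
        using finS by (simp add: powr_sum MS_def sum_distrib_left)
      finally show "real (\<Prod>k\<in>S. num_msgs n (M k)) \<le> 2 powr (real n * MS)" .
    qed (auto intro!: num_msgs_le prod_nonneg)
    also have "2 powr (real n * MS) = (2 powr (real n * (MS / D))) ^ D"
      using D1 by (simp flip: powr_realpow add: powr_powr)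
    also have "2 ^ D * (2 powr (real n * (MS / D))) ^ D * (2 * real D ^ D * 2 powr (real n * r)) ^ D =
       (8 * real D ^ D * (2 powr (real n * (MS / D)) * 2 powr (real n * r)) / 2) ^ D"
      unfolding power_mult_distrib[symmetric] by (rule arg_cong[where f = "\<lambda>x. x ^ D"]) simp
    also have "\<dots> \<le> (2 powr (real n * \<delta>) * (2 powr (real n * (MS / D)) * 2 powr (real n * r)) / 2) ^ D"
      using big by (intro power_mono divide_right_mono mult_right_mono) auto
    also have "\<dots> = (2 powr (real n * R) / 2) ^ D"
      by (simp flip: powr_add add: \<delta>_def algebra_simps)
    also have "\<dots> \<le> real (num_msgs n R) ^ D" using half by (intro power_mono) auto
    finally have size: "2 * real (\<Prod>k\<in>S. num_msgs n (M k)) * (2 * real D ^ D * real (num_msgs n r)) ^ D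
      \<le> real (num_msgs n R) ^ D" .
    have "\<exists>(F :: (nat \<Rightarrow> nat) \<Rightarrow> nat \<Rightarrow> 'x) \<psi>. sym_err W S n (num_msgs n r) F \<psi> \<le> real K * (2 * real (D ^ K) * \<epsilon>')"
      by (rule sym_code_of_cache_code[OF deg K S, where V = "\<lambda>k. num_msgs n (M k)" and L = "num_msgs n R" and g = g and f = f and \<phi> = \<phi>])
        (use code size \<epsilon>' r(1) R0 num_msgs_ge_1[of R n] num_msgs_ge_1[of r n] in auto)
    then show "\<exists>(f :: (nat \<Rightarrow> nat) \<Rightarrow> nat \<Rightarrow> 'x) \<phi>. sym_err W S n (num_msgs n r) f \<phi> < \<epsilon>"
      using \<epsilon>'\<epsilon> by (meson order_le_less_trans)
  qed
qed (use r in simp)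

section \<open>The bound for every set of receivers\<close>

theorem theorem4:
  fixes W :: "'x::finite \<Rightarrow> (nat \<Rightarrow> 'y::finite) pmf"
    and K D :: nat and M :: "nat \<Rightarrow> real"
  assumes "K \<ge> 1" and "D \<ge> K" and "degraded W K"
    and "\<forall>k\<in>{1..K}. M k \<ge> 0"
  shows "cache_capacity W K D M \<le>
    Min ((\<lambda>S. sym_capacity W S + (\<Sum>k\<in>S. M k) / real D) ` {S. S \<subseteq> {1..K} \<and> S \<noteq> {}})"
proof (subst Min_ge_iff)
  show "(\<lambda>S. sym_capacity W S + (\<Sum>k\<in>S. M k) / real D) ` {S. S \<subseteq> {1..K} \<and> S \<noteq> {}} \<noteq> {}"
    using assms(1) by force
  have "cache_capacity W K D M \<le> sym_capacity W S + (\<Sum>k\<in>S. M k) / real D"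
    if S: "S \<subseteq> {1..K}" "S \<noteq> {}" for S
    unfolding cache_capacity_def
  proof (rule cSup_least)
    show "{R. cache_achievable W K D M R} \<noteq> {}" using cache_achievable_0[OF assms(4)] by blast
    fix R assume "R \<in> {R. cache_achievable W K D M R}"
    then have R: "cache_achievable W K D M R" by simp
    have finS: "finite S" using S finite_subset by blast
    have "bdd_above {r. sym_achievable W S r}"
      using sym_achievable_bounded[OF finS S(2)] by (intro bdd_aboveI) auto
    then have upper: "r \<le> sym_capacity W S" if "sym_achievable W S r" for r
      unfolding sym_capacity_def using that by (intro cSup_upper) auto
    have "R - (\<Sum>k\<in>S. M k) / real D \<le> sym_capacity W S"
    \<comment> \<open>The conversion loses an arbitrarily small rate, so it is applied strictly
      below the target.\<close>
    proof (rule dense_le)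
      fix r assume r: "r < R - (\<Sum>k\<in>S. M k) / real D"
      show "r \<le> sym_capacity W S"
      \<comment> \<open>Achievable rates are nonnegative by definition; for negative
        \<open>r\<close> the rate zero code suffices.\<close>
      proof (cases "r \<ge> 0")
        case True
        then show ?thesis
          using sym_achievable_of_cache_achievable[OF assms(3,2) S assms(4) R _ r] upper by blast
      next
        case False
        then show ?thesis using upper[OF sym_achievable_0[OF finS]] by linarith
      qed
    qed
    then show "R \<le> sym_capacity W S + (\<Sum>k\<in>S. M k) / real D" by linarith
  qed
  then show "\<forall>a\<in>(\<lambda>S. sym_capacity W S + (\<Sum>k\<in>S. M k) / real D) ` {S. S \<subseteq> {1..K} \<and> S \<noteq> {}}.
      cache_capacity W K D M \<le> a" by blast
qed auto

end
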